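(* Let $G$ be a (topologically) finitely generated profinite group that is Fitting-free and let $c$ be a non-negative integer. Then $G$ is hereditarily JNN$_c$F if and only if there is a descending sequence $G\geq H_0>H_1>H_2>\cdots$ of open normal subgroups of $G$ such that (i) $\bigcap_{n=0}^{\infty}H_n=1$, and (ii) if $L$ is an open subgroup of $G$ that is normalized by $H_{n-1}$ for some $n\geq 1$, then either $\gamma_{c+1}(L)\leq H_{n-1}$ or $\gamma_{c+1}(H_n)\leq\gamma_{c+1}(L)$.
   Context: The lower central series of a profinite group is $\gamma_1(K)=K$, $\gamma_{i+1}(K)=[\gamma_i(K),K]$, with $[\cdot,\cdot]$ denoting closed commutator subgroups. A profinite group is virtually class-$c$ nilpotent if it has a subgroup $H$ of finite index (equivalently, an open subgroup $H$) with $\gamma_{c+1}(H)=1$. A profinite group $G$ is JNN$_c$F if $G$ is not virtually class-$c$ nilpotent but $G/N$ is virtually class-$c$ nilpotent for every non-trivial closed normal subgroup $N$ of $G$; it is hereditarily JNN$_c$F if every open subgroup of $G$ is JNN$_c$F. A profinite group is Fitting-free if it has no non-trivial abelian closed normal subgroup. In (ii), the dichotomy is required for each pair $(L,n)$ with $n\geq 1$ such that $L$ is an open subgroup normalized by $H_{n-1}$. *)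

theory Defs
  imports "HOL-Algebra.Algebra" "HOL-Analysis.Analysis"
begin

section \<open>Profinite groups\<close>

locale topological_group = group G for G (structure) +
  fixes T :: "'a topology"
  assumes topspace_eq: "topspace T = carrier G"
    and continuous_mult: "continuous_map (prod_topology T T) T (\<lambda>(x, y). x \<otimes> y)"
    and continuous_inv: "continuous_map T T (\<lambda>x. inv x)"

locale profinite_group = topological_group +
  assumes compact: "compact_space T"
    and Hausdorff: "Hausdorff_space T"
    and totally_disconnected: "\<And>x. x \<in> topspace T \<Longrightarrow> connected_component_of_set T x = {x}"

definition open_subgroup :: "('a, 'b) monoid_scheme \<Rightarrow> 'a topology \<Rightarrow> 'a set \<Rightarrow> bool" where
  "open_subgroup G T H \<longleftrightarrow> subgroup H G \<and> openin T H"

definition topologically_finitely_generated ::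
    "('a, 'b) monoid_scheme \<Rightarrow> 'a topology \<Rightarrow> bool" where
  "topologically_finitely_generated G T \<longleftrightarrow>
     (\<exists>S. finite S \<and> S \<subseteq> carrier G \<and> T closure_of generate G S = carrier G)"

definition fitting_free :: "('a, 'b) monoid_scheme \<Rightarrow> 'a topology \<Rightarrow> bool" where
  "fitting_free G T \<longleftrightarrow>
     (\<forall>A. A \<lhd> G \<and> closedin T A \<and> comm_group (G\<lparr>carrier := A\<rparr>) \<longrightarrow> A = {\<one>\<^bsub>G\<^esub>})"


section \<open>Quotient topology\<close>

text \<open>The elements of \<^term>\<open>G Mod N\<close> are cosets, so \<open>\<Union>U\<close> is the preimage of \<open>U\<close> under
  the projection.\<close>

definition coset_topology ::
    "('a, 'b) monoid_scheme \<Rightarrow> 'a topology \<Rightarrow> 'a set \<Rightarrow> 'a set topology" where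
  "coset_topology G T N = topology (\<lambda>U. U \<subseteq> carrier (G Mod N) \<and> openin T (\<Union>U))"

lemma (in topological_group) openin_coset_topology:
  assumes "N \<lhd> G"
  shows "openin (coset_topology G T N) U \<longleftrightarrow> U \<subseteq> carrier (G Mod N) \<and> openin T (\<Union>U)"
proof -
  have sub: "subgroup N G"
    using assms by (rule normal_imp_subgroup)
  have disj: "A \<inter> B = {}" if "A \<in> rcosets N" "B \<in> rcosets N" "A \<noteq> B" for A B
    using rcos_disjoint[OF sub] that by (auto simp: pairwise_def disjnt_def)
  have inter: "\<Union>(U \<inter> V) = \<Union>U \<inter> \<Union>V" if "U \<subseteq> rcosets N" "V \<subseteq> rcosets N" for U V
    using that disj by blast
  let ?Q = "\<lambda>U. U \<subseteq> rcosets N \<and> openin T (\<Union>U)"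
  have "?Q (U \<inter> V)" if "?Q U" "?Q V" for U V
    using that inter[of U V] by auto
  moreover have "?Q (\<Union>\<K>)" if "\<forall>U\<in>\<K>. ?Q U" for \<K>
  proof -
    have "\<Union>(\<Union>\<K>) = (\<Union>U\<in>\<K>. \<Union>U)" by blast
    moreover have "openin T (\<Union>U\<in>\<K>. \<Union>U)"
      using that by (intro openin_Union) auto
    ultimately show ?thesis
      using that by auto
  qed
  ultimately have "istopology ?Q"
    unfolding istopology_def by blast
  then show ?thesis
    by (simp add: coset_topology_def FactGroup_def topology_inverse')
qed


section \<open>Lower central series and the JNN\<open>\<^sub>c\<close>F property\<close>

definition closed_commutator ::
    "('a, 'b) monoid_scheme \<Rightarrow> 'a topology \<Rightarrow> 'a set \<Rightarrow> 'a set \<Rightarrow> 'a set" where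
  "closed_commutator G T A B =
     T closure_of generate G
       (\<Union>a\<in>A. \<Union>b\<in>B. {a \<otimes>\<^bsub>G\<^esub> b \<otimes>\<^bsub>G\<^esub> inv\<^bsub>G\<^esub> a \<otimes>\<^bsub>G\<^esub> inv\<^bsub>G\<^esub> b})"

text \<open>The series of a subgroup \<open>K\<close> of \<open>G\<close>, indexed from 1; the value at index 0 is a dummy.
  Closures are taken in \<open>G\<close>, which for closed \<open>K\<close> (in particular for open \<open>K\<close>)
  is the same as taking them in \<open>K\<close>.\<close>

fun lower_central ::
    "('a, 'b) monoid_scheme \<Rightarrow> 'a topology \<Rightarrow> nat \<Rightarrow> 'a set \<Rightarrow> 'a set" where
  "lower_central G T 0 K = K"
| "lower_central G T (Suc 0) K = K"
| "lower_central G T (Suc (Suc i)) K = closed_commutator G T (lower_central G T (Suc i) K) K"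

definition virtually_nilpotent_of_class ::
    "nat \<Rightarrow> ('a, 'b) monoid_scheme \<Rightarrow> 'a topology \<Rightarrow> bool" where
  "virtually_nilpotent_of_class c G T \<longleftrightarrow>
     (\<exists>H. open_subgroup G T H \<and> lower_central G T (c + 1) H = {\<one>\<^bsub>G\<^esub>})"

definition JNNF :: "nat \<Rightarrow> ('a, 'b) monoid_scheme \<Rightarrow> 'a topology \<Rightarrow> bool" where
  "JNNF c G T \<longleftrightarrow>
     \<not> virtually_nilpotent_of_class c G T \<and>
     (\<forall>N. N \<lhd> G \<and> closedin T N \<and> N \<noteq> {\<one>\<^bsub>G\<^esub>} \<longrightarrow>
        virtually_nilpotent_of_class c (G Mod N) (coset_topology G T N))"

definition hereditarily_JNNF :: "nat \<Rightarrow> ('a, 'b) monoid_scheme \<Rightarrow> 'a topology \<Rightarrow> bool" where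
  "hereditarily_JNNF c G T \<longleftrightarrow>
     (\<forall>U. open_subgroup G T U \<longrightarrow> JNNF c (G\<lparr>carrier := U\<rparr>) (subtopology T U))"

end

theory Submission
  imports Defs
begin

text \<open>
  Write \<open>\<gamma>\<close> for \<open>\<gamma>\<^bsub>c+1\<^esub>\<close>. For the forward direction, let \<open>K\<close> be open and normal in \<open>G\<close>. An open \<open>L\<close> normalized
  by \<open>K\<close> is normal in one of the finitely many subgroups \<open>M \<ge> K\<close>, so it suffices to find, for each
  such \<open>M\<close>, one open \<open>U\<close> with \<open>\<gamma>(U) \<le> R\<close> for all closed normal \<open>R\<close> of \<open>M\<close> not contained in \<open>K\<close>.
  Near a fixed \<open>R\<close> this works because \<open>M\<close> has no non-trivial finite normal subgroup: the closed normal
  subgroup \<open>\<gamma>(R) \<noteq> 1\<close> then contains a closed normal \<open>W \<noteq> 1\<close> consisting of non-generators, and if \<open>V\<close> is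
  open with \<open>\<gamma>(V) \<le> W\<close>, then \<open>R \<le> R'V\<close> gives \<open>\<gamma>(R) \<le> R'\<gamma>(V) \<le> R'W\<close>, hence \<open>\<gamma>(R) \<le> R'\<close>. A compactness
  argument makes \<open>U\<close> uniform in \<open>R\<close>. Finite generation is needed only to have countably many open
  subgroups, so that a sequence \<open>(H\<^sub>n)\<close> can have trivial intersection.

  Conversely, if \<open>N\<close> is closed, normalized by \<open>H\<^sub>k\<close>, and \<open>\<gamma>(N)\<close> is not contained in \<open>H\<^bsub>n-1\<^esub>\<close>, \<open>n > k\<close>, then the
  dichotomy for \<open>L = N H\<^sub>m\<close> yields \<open>\<gamma>(H\<^sub>n) \<le> N H\<^sub>m\<close> for all \<open>m \<ge> k\<close>, so \<open>\<gamma>(H\<^sub>n) \<le> N\<close>. Applied to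
  \<open>N = C\<^sub>G(H\<^sub>k)\<close>, which meets \<open>H\<^sub>k\<close> trivially, this gives \<open>C\<^sub>G(H\<^sub>k) = 1\<close>; hence open subgroups have no
  non-trivial finite normal subgroup, and from that they inherit being Fitting-free, so \<open>\<gamma>(N) \<noteq> 1\<close>
  whenever \<open>N \<noteq> 1\<close> is closed and normal in an open subgroup.
\<close>

section \<open>Topological groups and the lower central series\<close>

context group
begin

lemma conj_mult:
  assumes "g \<in> carrier G" "x \<in> carrier G" "y \<in> carrier G"
  shows "g \<otimes> (x \<otimes> y) \<otimes> inv g = (g \<otimes> x \<otimes> inv g) \<otimes> (g \<otimes> y \<otimes> inv g)"
proof -
  have "inv g \<otimes> (g \<otimes> (y \<otimes> inv g)) = y \<otimes> inv g"
    using assms by (simp flip: m_assoc)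
  with assms show ?thesis by (simp add: m_assoc)
qed
lemma conj_inv:
  assumes "g \<in> carrier G" "x \<in> carrier G"
  shows "g \<otimes> inv x \<otimes> inv g = inv (g \<otimes> x \<otimes> inv g)"
  using assms by (simp add: m_assoc inv_mult_group)
text \<open>Everything before the last commutator is \<open>a\<close> times conjugates of
  \<open>b\<close>, \<open>inv a\<close>, \<open>inv b\<close> by words in \<open>x\<close> and
  \<open>v\<close>. So modulo a subgroup that contains \<open>a\<close>, \<open>b\<close> and is
  merely normalized by the group generated by \<open>x\<close> and \<open>v\<close>, the commutator
  of \<open>a \<otimes> x\<close> and \<open>b \<otimes> v\<close> is that of \<open>x\<close> and
  \<open>v\<close>.\<close>

lemma commutator_mult_expand:
  assumes "a \<in> carrier G" "b \<in> carrier G" "x \<in> carrier G" "v \<in> carrier G"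
  shows "(a \<otimes> x) \<otimes> (b \<otimes> v) \<otimes> inv (a \<otimes> x) \<otimes> inv (b \<otimes> v) =
    (a \<otimes> (x \<otimes> b \<otimes> inv x) \<otimes> (x \<otimes> v \<otimes> inv x \<otimes> inv a \<otimes> inv (x \<otimes> v \<otimes> inv x)) \<otimes>
     ((x \<otimes> v \<otimes> inv x \<otimes> inv v) \<otimes> inv b \<otimes> inv (x \<otimes> v \<otimes> inv x \<otimes> inv v))) \<otimes>
     (x \<otimes> v \<otimes> inv x \<otimes> inv v)"
proof -
  have c1: "inv p \<otimes> (p \<otimes> q) = q" "p \<otimes> (inv p \<otimes> q) = q" if "p \<in> carrier G" "q \<in> carrier G" for p q
    using that by (simp_all flip: m_assoc)
  show ?thesis using assms by (simp add: m_assoc inv_mult_group c1)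
qed

end

section \<open>Continuity, open subgroups and closures of subgroups\<close>

context topological_group
begin

lemma continuous_mult':
  assumes "continuous_map Y T f" "continuous_map Y T g"
  shows "continuous_map Y T (\<lambda>x. f x \<otimes> g x)"
proof -
  have "continuous_map Y (prod_topology T T) (\<lambda>x. (f x, g x))"
    using assms by (simp add: continuous_map_paired)
  from continuous_map_compose[OF this continuous_mult] show ?thesis
    by (simp add: o_def)
qed

lemma continuous_inv':
  "continuous_map Y T f \<Longrightarrow> continuous_map Y T (\<lambda>x. inv f x)"
  using continuous_map_compose[OF _ continuous_inv] by (simp add: o_def)

lemma continuous_id': "continuous_map T T (\<lambda>x. x)"
  by simp

lemma continuous_const': "a \<in> carrier G \<Longrightarrow> continuous_map Y T (\<lambda>x. a)"
  using topspace_eq by simp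

lemmas continuous_group_intros = continuous_mult' continuous_inv' continuous_id' continuous_const'

lemma openin_preimage:
  "continuous_map T T f \<Longrightarrow> openin T U \<Longrightarrow> openin T {x \<in> carrier G. f x \<in> U}"
  using openin_continuous_map_preimage[of T T f U] by (simp add: topspace_eq)

lemma closedin_preimage:
  "continuous_map T T f \<Longrightarrow> closedin T U \<Longrightarrow> closedin T {x \<in> carrier G. f x \<in> U}"
  using closedin_continuous_map_preimage[of T T f U] by (simp add: topspace_eq)

lemma open_subset_carrier: "openin T U \<Longrightarrow> U \<subseteq> carrier G"
  using openin_subset topspace_eq by blast

lemma closed_subset_carrier: "closedin T U \<Longrightarrow> U \<subseteq> carrier G"
  using closedin_subset topspace_eq by blast

text \<open>The product is a union of left translates of \<open>U\<close>, each of them the preimage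
  of \<open>U\<close> under a translation.\<close>

lemma openin_set_mult:
  assumes U: "openin T U" and A: "A \<subseteq> carrier G"
  shows "openin T (A <#> U)"
proof -
  have "A <#> U = (\<Union>a\<in>A. {x \<in> carrier G. inv a \<otimes> x \<in> U})"
  proof (intro equalityI subsetI)
    fix x assume "x \<in> A <#> U"
    then obtain a u where au: "a \<in> A" "u \<in> U" "x = a \<otimes> u"
      unfolding set_mult_def by auto
    moreover have "a \<in> carrier G" "u \<in> carrier G"
      using au A open_subset_carrier[OF U] by auto
    ultimately have "x \<in> carrier G" "inv a \<otimes> x = u"
      by (auto simp flip: m_assoc)
    then show "x \<in> (\<Union>a\<in>A. {x \<in> carrier G. inv a \<otimes> x \<in> U})"
      using au(2) by (intro UN_I[OF au(1)]) simp
  next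
    fix x assume "x \<in> (\<Union>a\<in>A. {x \<in> carrier G. inv a \<otimes> x \<in> U})"
    then obtain a where a: "a \<in> A" "x \<in> carrier G" "inv a \<otimes> x \<in> U" by auto
    then have "x = a \<otimes> (inv a \<otimes> x)"
      using A by (auto simp: m_assoc[symmetric])
    then show "x \<in> A <#> U"
      unfolding set_mult_def using a by blast
  qed
  moreover have "openin T {x \<in> carrier G. inv a \<otimes> x \<in> U}" if "a \<in> A" for a
    using that A by (intro openin_preimage[OF _ U] continuous_group_intros) auto
  ultimately show ?thesis
    by auto
qed

text \<open>A subgroup that contains a neighbourhood \<open>U\<close> of the identity is the union
  of the translates of \<open>U\<close> by its own elements.\<close>

lemma openin_subgroup_superset:
  assumes H: "subgroup H G" and U: "openin T U" "\<one> \<in> U" "U \<subseteq> H"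
  shows "openin T H"
proof -
  have "H = H <#> U"
  proof
    show "H \<subseteq> H <#> U"
      using U(2) subgroup.subset[OF H] unfolding set_mult_def by (force intro: r_one[symmetric])
    show "H <#> U \<subseteq> H"
      using U(3) H unfolding set_mult_def by (auto intro: subgroup.m_closed)
  qed
  then show ?thesis
    using openin_set_mult[OF U(1) subgroup.subset[OF H]] by simp
qed

lemma openin_subgroup_mono:
  assumes "subgroup H G" "subgroup U G" "openin T U" "U \<subseteq> H"
  shows "openin T H"
  using openin_subgroup_superset[OF assms(1,3) subgroup.one_closed[OF assms(2)] assms(4)] .

text \<open>The complement is a union of left cosets, all of them open.\<close>

lemma open_subgroup_closed:
  assumes H: "subgroup H G" and oH: "openin T H"
  shows "closedin T H"
proof -
  have "carrier G - H = (carrier G - H) <#> H"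
  proof
    show "carrier G - H \<subseteq> (carrier G - H) <#> H"
      using subgroup.one_closed[OF H] unfolding set_mult_def by (force intro: r_one[symmetric])
    show "(carrier G - H) <#> H \<subseteq> carrier G - H"
    proof
      fix x assume "x \<in> (carrier G - H) <#> H"
      then obtain a h where x: "a \<in> carrier G" "a \<notin> H" "h \<in> H" "x = a \<otimes> h"
        unfolding set_mult_def by auto
      have h: "h \<in> carrier G" using x(3) subgroup.mem_carrier[OF H] by blast
      have "a = x \<otimes> inv h" using x h by (simp add: m_assoc)
      then have "x \<notin> H" using x(2,3) H by (auto simp: subgroup.m_closed subgroup.m_inv_closed)
      then show "x \<in> carrier G - H" using x h by auto
    qed
  qed
  then have "openin T (carrier G - H)"
    using openin_set_mult[OF oH, of "carrier G - H"] by simp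
  then show ?thesis
    using subgroup.subset[OF H] by (simp add: closedin_def topspace_eq)
qed

text \<open>One variable moves at a time: left translations by elements of \<open>H\<close> preserve
  the closure; then, for \<open>y\<close> in the closure, the closed set of \<open>x\<close> with
  \<open>x \<otimes> y\<close> in the closure contains \<open>H\<close>, hence the closure.\<close>

lemma subgroup_closure_of:
  assumes H: "subgroup H G"
  shows "subgroup (T closure_of H) G"
proof -
  let ?C = "T closure_of H"
  have sub: "H \<subseteq> ?C"
    using subgroup.subset[OF H] by (simp add: closure_of_subset topspace_eq)
  have Csub: "?C \<subseteq> carrier G"
    using closure_of_subset_topspace[of T H] by (simp add: topspace_eq)
  have cl: "closedin T ?C" by simp
  have left: "h \<otimes> x \<in> ?C" if "h \<in> H" "x \<in> ?C" for h x
  proof -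
    have h: "h \<in> carrier G" using that subgroup.mem_carrier[OF H] by blast
    have "?C \<subseteq> {x \<in> carrier G. h \<otimes> x \<in> ?C}"
      using that H sub subgroup.subset[OF H]
      by (intro closure_of_minimal closedin_preimage cl continuous_group_intros h)
         (auto intro: subgroup.m_closed)
    then show ?thesis using that by blast
  qed
  have mult: "x \<otimes> y \<in> ?C" if "x \<in> ?C" "y \<in> ?C" for x y
  proof -
    have "?C \<subseteq> {x \<in> carrier G. x \<otimes> y \<in> ?C}"
      using that left subgroup.subset[OF H] Csub
      by (intro closure_of_minimal closedin_preimage cl continuous_group_intros) auto
    then show ?thesis using that by blast
  qed
  have inv: "inv x \<in> ?C" if "x \<in> ?C" for x
  proof -
    have "?C \<subseteq> {x \<in> carrier G. inv x \<in> ?C}"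
      using H sub subgroup.subset[OF H]
      by (intro closure_of_minimal closedin_preimage cl continuous_group_intros)
         (auto intro: subgroup.m_inv_closed)
    then show ?thesis using that by blast
  qed
  show ?thesis
    by (rule subgroupI) (use mult inv Csub sub subgroup.one_closed[OF H] in auto)
qed

lemma closure_of_generate_least:
  assumes "subgroup C G" "closedin T C" "S \<subseteq> C"
  shows "T closure_of generate G S \<subseteq> C"
  using assms by (intro closure_of_minimal generate_subgroup_incl)

lemma subset_closure_of_generate:
  assumes "S \<subseteq> carrier G"
  shows "S \<subseteq> T closure_of generate G S"
proof -
  have "S \<subseteq> generate G S" by (auto intro: generate.incl)
  also have "\<dots> \<subseteq> T closure_of generate G S"
    using generate_incl[OF assms] by (simp add: closure_of_subset topspace_eq)
  finally show ?thesis .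
qed

section \<open>Closed commutators and the lower central series\<close>

lemma commutators_subset_carrier:
  assumes "A \<subseteq> carrier G" "B \<subseteq> carrier G"
  shows "(\<Union>a\<in>A. \<Union>b\<in>B. {a \<otimes> b \<otimes> inv a \<otimes> inv b}) \<subseteq> carrier G"
  using assms by (auto intro!: m_closed inv_closed)

lemma closed_commutator_least:
  assumes "subgroup C G" "closedin T C"
    and "\<And>a b. a \<in> A \<Longrightarrow> b \<in> B \<Longrightarrow> a \<otimes> b \<otimes> inv a \<otimes> inv b \<in> C"
  shows "closed_commutator G T A B \<subseteq> C"
  unfolding closed_commutator_def using assms by (intro closure_of_generate_least) auto

lemma commutator_in_closed_commutator:
  assumes "A \<subseteq> carrier G" "B \<subseteq> carrier G" "a \<in> A" "b \<in> B"
  shows "a \<otimes> b \<otimes> inv a \<otimes> inv b \<in> closed_commutator G T A B"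
  unfolding closed_commutator_def
  using subset_closure_of_generate[OF commutators_subset_carrier[OF assms(1,2)]] assms(3,4) by blast

lemma closedin_closed_commutator: "closedin T (closed_commutator G T A B)"
  unfolding closed_commutator_def by simp

lemma subgroup_closed_commutator:
  assumes "A \<subseteq> carrier G" "B \<subseteq> carrier G"
  shows "subgroup (closed_commutator G T A B) G"
  unfolding closed_commutator_def
  using assms by (intro subgroup_closure_of generate_is_subgroup commutators_subset_carrier)

lemma closed_commutator_mono:
  assumes "A \<subseteq> A'" "B \<subseteq> B'"
  shows "closed_commutator G T A B \<subseteq> closed_commutator G T A' B'"
  unfolding closed_commutator_def using assms
  by (intro closure_of_mono mono_generate) blast

lemma lower_central_mono:
  "A \<subseteq> B \<Longrightarrow> lower_central G T i A \<subseteq> lower_central G T i B"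
proof (induction i)
  case (Suc i)
  then show ?case by (cases i) (simp_all add: closed_commutator_mono)
qed simp

lemma lower_central_closed_subgroup:
  assumes "subgroup K G" "closedin T K"
  shows "subgroup (lower_central G T i K) G \<and> closedin T (lower_central G T i K) \<and> lower_central G T i K \<subseteq> K"
proof (induction i)
  case (Suc i)
  show ?case
  proof (cases i)
    case (Suc j)
    have sub: "lower_central G T i K \<subseteq> K" using Suc.IH by blast
    have Kc: "K \<subseteq> carrier G" using assms(1) subgroup.subset by blast
    have "a \<otimes> b \<otimes> inv a \<otimes> inv b \<in> K" if "a \<in> lower_central G T i K" "b \<in> K" for a b
      using that sub assms(1) by (auto intro!: subgroup.m_closed subgroup.m_inv_closed)
    then have "closed_commutator G T (lower_central G T i K) K \<subseteq> K"
      by (rule closed_commutator_least[OF assms])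
    moreover have "subgroup (closed_commutator G T (lower_central G T i K) K) G"
      using sub Kc by (intro subgroup_closed_commutator) auto
    ultimately show ?thesis
      using Suc closedin_closed_commutator by simp
  qed (use assms in auto)
qed (use assms in auto)

lemmas lower_central_subgroup = lower_central_closed_subgroup[THEN conjunct1]
  and lower_central_closedin = lower_central_closed_subgroup[THEN conjunct2, THEN conjunct1]
  and lower_central_subset = lower_central_closed_subgroup[THEN conjunct2, THEN conjunct2]

lemma subgroup_conj_preimage:
  assumes "subgroup C G" "g \<in> carrier G"
  shows "subgroup {x \<in> carrier G. g \<otimes> x \<otimes> inv g \<in> C} G"
proof (rule subgroupI)
  have "\<one> \<in> {x \<in> carrier G. g \<otimes> x \<otimes> inv g \<in> C}"
    using assms by (simp add: subgroup.one_closed)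
  then show "{x \<in> carrier G. g \<otimes> x \<otimes> inv g \<in> C} \<noteq> {}" by blast
qed (use assms in \<open>auto simp: conj_mult[OF assms(2)] conj_inv[OF assms(2)]
       intro: subgroup.m_closed subgroup.m_inv_closed\<close>)

text \<open>The elements whose conjugate by \<open>g\<close> lies in the next term form a closed
  subgroup, so only commutators have to be tested, and conjugation turns these into commutators. A
  single \<open>g\<close> is fixed because later \<open>K\<close> is normalized only by some
  subgroup.\<close>

lemma lower_central_conj:
  assumes K: "subgroup K G" "closedin T K" and g: "g \<in> carrier G"
    and conj: "\<And>k. k \<in> K \<Longrightarrow> g \<otimes> k \<otimes> inv g \<in> K"
    and x: "x \<in> lower_central G T i K"
  shows "g \<otimes> x \<otimes> inv g \<in> lower_central G T i K"
  using x
proof (induction i arbitrary: x)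
  case (Suc i)
  show ?case
  proof (cases i)
    case (Suc j)
    let ?L = "lower_central G T i K"
    let ?C = "closed_commutator G T ?L K"
    have Kc: "K \<subseteq> carrier G" using K(1) subgroup.subset by blast
    have Lc: "?L \<subseteq> carrier G" using Kc lower_central_subset[OF K] by blast
    have sC: "subgroup ?C G" by (rule subgroup_closed_commutator[OF Lc Kc])
    have "?C \<subseteq> {x \<in> carrier G. g \<otimes> x \<otimes> inv g \<in> ?C}"
    proof (rule closed_commutator_least)
      show "subgroup {x \<in> carrier G. g \<otimes> x \<otimes> inv g \<in> ?C} G"
        by (rule subgroup_conj_preimage[OF sC g])
      show "closedin T {x \<in> carrier G. g \<otimes> x \<otimes> inv g \<in> ?C}"
        using g by (intro closedin_preimage continuous_group_intros closedin_closed_commutator) auto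
      fix a b assume ab: "a \<in> ?L" "b \<in> K"
      then have c: "a \<in> carrier G" "b \<in> carrier G" using Lc Kc by auto
      have "g \<otimes> (a \<otimes> b \<otimes> inv a \<otimes> inv b) \<otimes> inv g =
         (g \<otimes> a \<otimes> inv g) \<otimes> (g \<otimes> b \<otimes> inv g) \<otimes> inv (g \<otimes> a \<otimes> inv g) \<otimes> inv (g \<otimes> b \<otimes> inv g)"
        using c g
        by (simp only: conj_mult[OF g] conj_inv[OF g, symmetric] m_closed inv_closed)
      also have "\<dots> \<in> ?C"
        by (rule commutator_in_closed_commutator[OF Lc Kc Suc.IH[OF ab(1)] conj[OF ab(2)]])
      finally show "a \<otimes> b \<otimes> inv a \<otimes> inv b \<in> {x \<in> carrier G. g \<otimes> x \<otimes> inv g \<in> ?C}"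
        using c by simp
    qed
    then show ?thesis using Suc.prems Suc by auto
  qed (use Suc.prems conj in auto)
qed (use conj in auto)

lemma lower_central_normal:
  assumes "K \<lhd> G" "closedin T K"
  shows "lower_central G T i K \<lhd> G"
proof -
  have K: "subgroup K G" using assms(1) normal_imp_subgroup by blast
  show ?thesis
    unfolding normal_inv_iff
    using lower_central_subgroup[OF K assms(2)] lower_central_conj[OF K assms(2)] assms(1) normal_inv_iff
    by blast
qed

end

section \<open>Products of subgroups and quotients\<close>

lemma in_set_mult_iff: "x \<in> A <#>\<^bsub>G\<^esub> B \<longleftrightarrow> (\<exists>a\<in>A. \<exists>b\<in>B. x = a \<otimes>\<^bsub>G\<^esub> b)"
  unfolding set_mult_def by auto

lemma set_mult_supersetE:
  assumes "S \<subseteq> A <#>\<^bsub>G\<^esub> B" "x \<in> S"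
  obtains a b where "a \<in> A" "b \<in> B" "x = a \<otimes>\<^bsub>G\<^esub> b"
  using subsetD[OF assms] unfolding in_set_mult_iff by blast

context group
begin

lemma subset_set_mult_left:
  assumes "subgroup B G" "A \<subseteq> carrier G"
  shows "A \<subseteq> A <#> B"
proof
  fix x assume "x \<in> A"
  then show "x \<in> A <#> B"
    using assms subgroup.one_closed[OF assms(1)]
    unfolding in_set_mult_iff by (intro bexI[of _ x] bexI[of _ \<one>]) auto
qed

lemma subset_set_mult_right:
  assumes "subgroup A G" "B \<subseteq> carrier G"
  shows "B \<subseteq> A <#> B"
proof
  fix x assume "x \<in> B"
  then show "x \<in> A <#> B"
    using assms subgroup.one_closed[OF assms(1)]
    unfolding in_set_mult_iff by (intro bexI[of _ \<one>] bexI[of _ x]) auto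
qed

lemma set_mult_subset_subgroup:
  assumes "subgroup C G" "A \<subseteq> C" "B \<subseteq> C"
  shows "A <#> B \<subseteq> C"
  using assms unfolding in_set_mult_iff subset_iff by (auto intro: subgroup.m_closed)

text \<open>Stated with \<open>V\<close> normalizing \<open>A\<close> and without normality in
  \<open>G\<close>, to cover an open \<open>L\<close> times a normal subgroup that normalizes
  it.\<close>

lemma subgroup_set_mult:
  assumes A: "subgroup A G" and V: "subgroup V G"
    and conj: "\<And>v a. v \<in> V \<Longrightarrow> a \<in> A \<Longrightarrow> v \<otimes> a \<otimes> inv v \<in> A"
  shows "subgroup (A <#> V) G"
proof (rule subgroupI)
  have Ac: "A \<subseteq> carrier G" and Vc: "V \<subseteq> carrier G"
    using A V subgroup.subset by blast+
  show "A <#> V \<subseteq> carrier G" using Ac Vc by (rule set_mult_closed)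
  show "A <#> V \<noteq> {}"
    using subset_set_mult_left[OF V Ac] subgroup.one_closed[OF A] by blast
next
  fix x assume "x \<in> A <#> V"
  then obtain a v where av: "a \<in> A" "v \<in> V" "x = a \<otimes> v"
    unfolding in_set_mult_iff by blast
  then have c: "a \<in> carrier G" "v \<in> carrier G"
    using subgroup.mem_carrier[OF A] subgroup.mem_carrier[OF V] by simp_all
  have iv: "inv v \<in> V" "inv a \<in> A"
    by (rule subgroup.m_inv_closed[OF V av(2)], rule subgroup.m_inv_closed[OF A av(1)])
  have "inv x = (inv v \<otimes> inv a \<otimes> inv (inv v)) \<otimes> inv v"
    using av(3) c by (simp add: inv_mult_group m_assoc)
  then show "inv x \<in> A <#> V"
    using conj[OF iv] iv(1) unfolding in_set_mult_iff by blast
  fix y assume "y \<in> A <#> V"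
  then obtain b w where bw: "b \<in> A" "w \<in> V" "y = b \<otimes> w"
    unfolding in_set_mult_iff by blast
  then have d: "b \<in> carrier G" "w \<in> carrier G"
    using subgroup.mem_carrier[OF A] subgroup.mem_carrier[OF V] by simp_all
  have "inv v \<otimes> (v \<otimes> w) = w" using c d by (simp flip: m_assoc)
  then have "x \<otimes> y = (a \<otimes> (v \<otimes> b \<otimes> inv v)) \<otimes> (v \<otimes> w)"
    using av(3) bw(3) c d by (simp add: m_assoc)
  moreover have "a \<otimes> (v \<otimes> b \<otimes> inv v) \<in> A"
    by (rule subgroup.m_closed[OF A av(1) conj[OF av(2) bw(1)]])
  moreover have "v \<otimes> w \<in> V" by (rule subgroup.m_closed[OF V av(2) bw(2)])
  ultimately show "x \<otimes> y \<in> A <#> V"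
    unfolding in_set_mult_iff by blast
qed

lemma normal_conj:
  "N \<lhd> G \<Longrightarrow> g \<in> carrier G \<Longrightarrow> n \<in> N \<Longrightarrow> g \<otimes> n \<otimes> inv g \<in> N"
  by (rule normal.inv_op_closed2)

lemma normal_set_mult:
  assumes "M \<lhd> G" "N \<lhd> G"
  shows "M <#> N \<lhd> G"
proof -
  have s: "subgroup M G" "subgroup N G" using assms normal_imp_subgroup by blast+
  have "subgroup (M <#> N) G"
    using normal_conj[OF assms(1)] subgroup.mem_carrier[OF s(2)] by (intro subgroup_set_mult s) blast
  moreover have "g \<otimes> x \<otimes> inv g \<in> M <#> N" if g: "g \<in> carrier G" and x: "x \<in> M <#> N" for g x
  proof -
    obtain m n where mn: "m \<in> M" "n \<in> N" "x = m \<otimes> n"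
      using x unfolding in_set_mult_iff by blast
    then have "g \<otimes> x \<otimes> inv g = (g \<otimes> m \<otimes> inv g) \<otimes> (g \<otimes> n \<otimes> inv g)"
      using conj_mult[OF g] s[THEN subgroup.mem_carrier] by simp
    then show ?thesis
      using normal_conj[OF assms(1) g mn(1)] normal_conj[OF assms(2) g mn(2)]
      unfolding in_set_mult_iff by blast
  qed
  ultimately show ?thesis unfolding normal_inv_iff by blast
qed

lemma normal_Inter:
  assumes "\<A> \<noteq> {}" "\<And>N. N \<in> \<A> \<Longrightarrow> N \<lhd> G"
  shows "\<Inter>\<A> \<lhd> G"
proof -
  have "subgroup (\<Inter>\<A>) G"
    using assms normal_imp_subgroup by (intro subgroups_Inter) auto
  then show ?thesis
    unfolding normal_inv_iff using assms(2) normal_conj by blast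
qed

lemma normal_restrict_iff:
  assumes "subgroup M G" "N \<subseteq> M"
  shows "N \<lhd> (G\<lparr>carrier := M\<rparr>) \<longleftrightarrow> subgroup N G \<and> (\<forall>x\<in>M. \<forall>h\<in>N. x \<otimes> h \<otimes> inv x \<in> N)"
proof -
  interpret M: group "G\<lparr>carrier := M\<rparr>" using assms(1) by (rule subgroup_imp_group)
  have "subgroup N (G\<lparr>carrier := M\<rparr>) \<longleftrightarrow> subgroup N G"
    using subgroup_incl[OF _ assms] incl_subgroup[OF assms(1)] assms(1) by blast
  then show ?thesis
    unfolding M.normal_inv_iff using m_inv_consistent[OF assms(1)] assms(2) by simp
qed

end

context topological_group
begin

text \<open>Modulo \<open>A\<close>, the series of \<open>A <#> V\<close> is that of
  \<open>V\<close>; the expansion of a commutator of products replaces the passage to a quotient, as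
  \<open>A\<close> is normalized only by \<open>V\<close>. Closedness of the products is a
  hypothesis here and comes from compactness in the profinite case.\<close>

lemma lower_central_set_mult_subset:
  assumes A: "subgroup A G" and V: "subgroup V G" "closedin T V"
    and conj: "\<And>v a. v \<in> V \<Longrightarrow> a \<in> A \<Longrightarrow> v \<otimes> a \<otimes> inv v \<in> A"
    and closed: "\<And>i. closedin T (A <#> lower_central G T i V)"
  shows "lower_central G T (Suc i) (A <#> V) \<subseteq> A <#> lower_central G T (Suc i) V"
proof (induction i)
  case (Suc i)
  let ?L = "lower_central G T (Suc i) V" and ?L' = "lower_central G T (Suc (Suc i)) V"
  have sL: "subgroup ?L G" "subgroup ?L' G" by (intro lower_central_subgroup[OF V])+
  have sub: "?L \<subseteq> V" "?L' \<subseteq> V" by (intro lower_central_subset[OF V])+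
  have carr: "x \<in> carrier G" if "x \<in> V \<or> x \<in> A \<or> x \<in> ?L \<or> x \<in> ?L'" for x
    using that sub subgroup.mem_carrier[OF V(1)] subgroup.mem_carrier[OF A] by blast
  have "closed_commutator G T (lower_central G T (Suc i) (A <#> V)) (A <#> V)
        \<subseteq> closed_commutator G T (A <#> ?L) (A <#> V)"
    by (intro closed_commutator_mono Suc.IH order_refl)
  also have "\<dots> \<subseteq> A <#> ?L'"
  proof (rule closed_commutator_least)
    show "subgroup (A <#> ?L') G"
      using conj sub by (intro subgroup_set_mult A sL) blast
    show "closedin T (A <#> ?L')" by (rule closed)
    fix p q assume "p \<in> A <#> ?L" "q \<in> A <#> V"
    then obtain a x b v where p: "a \<in> A" "x \<in> ?L" "p = a \<otimes> x" and q: "b \<in> A" "v \<in> V" "q = b \<otimes> v"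
      unfolding in_set_mult_iff by blast
    have x: "x \<in> V" using p sub by blast
    let ?w = "x \<otimes> v \<otimes> inv x" and ?c = "x \<otimes> v \<otimes> inv x \<otimes> inv v"
    have w: "?w \<in> V" using x q(2) V(1) by (auto intro!: subgroup.m_closed subgroup.m_inv_closed)
    have cV: "?c \<in> V" using w q(2) V(1) by (auto intro!: subgroup.m_closed subgroup.m_inv_closed)
    have c: "?c \<in> ?L'"
      using commutator_in_closed_commutator[of ?L V x v] p q carr by (simp add: subset_iff)
    have "p \<otimes> q \<otimes> inv p \<otimes> inv q =
      (a \<otimes> (x \<otimes> b \<otimes> inv x) \<otimes> (?w \<otimes> inv a \<otimes> inv ?w) \<otimes> (?c \<otimes> inv b \<otimes> inv ?c)) \<otimes> ?c"
      unfolding p(3) q(3) by (rule commutator_mult_expand) (use p q x carr in auto)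
    moreover have "a \<otimes> (x \<otimes> b \<otimes> inv x) \<otimes> (?w \<otimes> inv a \<otimes> inv ?w) \<otimes> (?c \<otimes> inv b \<otimes> inv ?c) \<in> A"
    proof -
      have "inv a \<in> A" "inv b \<in> A" using p(1) q(1) A by (simp_all add: subgroup.m_inv_closed)
      then show ?thesis
        by (intro subgroup.m_closed[OF A subgroup.m_closed[OF A subgroup.m_closed[OF A]]]
              p(1) conj[OF x q(1)] conj[OF w] conj[OF cV])
    qed
    ultimately show "p \<otimes> q \<otimes> inv p \<otimes> inv q \<in> A <#> ?L'"
      using c unfolding in_set_mult_iff by blast
  qed
  finally show ?case by simp
qed simp

lemma lower_central_subset_subgroup:
  assumes "subgroup M G" "closedin T M" "K \<subseteq> M"
  shows "lower_central G T i K \<subseteq> M"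
  using lower_central_mono[OF assms(3), of i] lower_central_subset[OF assms(1,2), of i] by blast

text \<open>Since \<open>M\<close> is closed, closures of subsets of \<open>M\<close> in
  \<open>G\<close> stay inside \<open>M\<close>, and generated subgroups and inverses agree as well.
  This lets results for the profinite group \<open>M\<close> be read in \<open>G\<close>.\<close>

lemma lower_central_restrict:
  assumes M: "subgroup M G" "closedin T M" and K: "K \<subseteq> M"
  shows "lower_central (G\<lparr>carrier := M\<rparr>) (subtopology T M) i K = lower_central G T i K"
proof (induction i)
  case (Suc i)
  show ?case
  proof (cases i)
    case (Suc j)
    let ?L = "lower_central G T i K"
    let ?C = "\<Union>a\<in>?L. \<Union>b\<in>K. {a \<otimes> b \<otimes> inv a \<otimes> inv b}"
    have L: "?L \<subseteq> M" by (rule lower_central_subset_subgroup[OF M K])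
    have eq: "(\<Union>a\<in>?L. \<Union>b\<in>K. {a \<otimes>\<^bsub>G\<lparr>carrier := M\<rparr>\<^esub> b \<otimes>\<^bsub>G\<lparr>carrier := M\<rparr>\<^esub>
        inv\<^bsub>G\<lparr>carrier := M\<rparr>\<^esub> a \<otimes>\<^bsub>G\<lparr>carrier := M\<rparr>\<^esub> inv\<^bsub>G\<lparr>carrier := M\<rparr>\<^esub> b}) = ?C"
      using subsetD[OF L] subsetD[OF K] m_inv_consistent[OF M(1)] by (intro SUP_cong refl) simp
    have CM: "?C \<subseteq> M"
      using L K M(1) by (auto intro!: subgroup.m_closed subgroup.m_inv_closed)
    have "generate (G\<lparr>carrier := M\<rparr>) ?C = generate G ?C"
      by (rule generate_consistent[OF CM M(1)])
    moreover have "generate G ?C \<subseteq> M" by (rule generate_subgroup_incl[OF CM M(1)])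
    moreover have "T closure_of generate G ?C \<subseteq> M"
      by (rule closure_of_generate_least[OF M CM])
    ultimately have "subtopology T M closure_of generate (G\<lparr>carrier := M\<rparr>) ?C = T closure_of generate G ?C"
      by (simp add: closure_of_subtopology Int_absorb1)
    then show ?thesis
      using Suc.IH eq Suc by (simp add: closed_commutator_def)
  qed simp
qed simp

lemma topspace_coset_topology:
  assumes N: "N \<lhd> G"
  shows "topspace (coset_topology G T N) = carrier (G Mod N)"
proof -
  have sN: "subgroup N G" using N by (rule normal_imp_subgroup)
  have "openin (coset_topology G T N) (carrier (G Mod N))"
    unfolding openin_coset_topology[OF N] using rcosets_part_G[OF sN] openin_topspace[of T]
    by (simp add: topspace_eq FactGroup_def)
  then show ?thesis
    using openin_coset_topology[OF N, of "topspace (coset_topology G T N)"] openin_subset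
    by blast
qed

lemma continuous_coset_map:
  assumes N: "N \<lhd> G"
  shows "continuous_map T (coset_topology G T N) (\<lambda>x. N #> x)"
proof -
  have sN: "subgroup N G" using N by (rule normal_imp_subgroup)
  show ?thesis
    unfolding continuous_map_def
  proof (intro conjI allI impI)
    show "(#>) N \<in> topspace T \<rightarrow> topspace (coset_topology G T N)"
      unfolding topspace_coset_topology[OF N] topspace_eq by (auto simp: FactGroup_def RCOSETS_def)
    fix U assume "openin (coset_topology G T N) U"
    then have U: "U \<subseteq> rcosets N" "openin T (\<Union>U)"
      unfolding openin_coset_topology[OF N] by (auto simp: FactGroup_def)
    \<comment> \<open>Cosets are disjoint, so the preimage of a set of cosets is its union, and
      openness of this union is what the quotient topology demands.\<close>
    have "{x \<in> topspace T. N #> x \<in> U} = \<Union>U"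
    proof (intro equalityI subsetI)
      fix x assume "x \<in> {x \<in> topspace T. N #> x \<in> U}"
      then show "x \<in> \<Union>U" using rcos_self[OF _ sN] topspace_eq by blast
    next
      fix x assume "x \<in> \<Union>U"
      then obtain C where C: "C \<in> U" "x \<in> C" by blast
      then obtain y where y: "y \<in> carrier G" "C = N #> y"
        using U(1) by (auto simp: RCOSETS_def)
      then have "N #> x = C" using repr_independence[OF _ y(1) sN] C(2) by simp
      moreover have "x \<in> carrier G"
        using C(2) y r_coset_subset_G[OF subgroup.subset[OF sN] y(1)] by blast
      ultimately show "x \<in> {x \<in> topspace T. N #> x \<in> U}"
        using C(1) topspace_eq by simp
    qed
    then show "openin T {x \<in> topspace T. N #> x \<in> U}" using U(2) by simp
  qed
qed

end

text \<open>Continuity and closedness of the homomorphism give the two inclusions showing that it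
  commutes with closure; on commutators and generated subgroups the equality is algebraic.\<close>

lemma closed_commutator_image:
  assumes hom: "group_hom G H f" and cont: "continuous_map T T' f" and closed: "closed_map T T' f"
    and top: "topspace T = carrier G" and AB: "A \<subseteq> carrier G" "B \<subseteq> carrier G"
  shows "closed_commutator H T' (f ` A) (f ` B) = f ` closed_commutator G T A B"
proof -
  interpret group_hom G H f by (rule hom)
  let ?C = "\<Union>a\<in>A. \<Union>b\<in>B. {a \<otimes>\<^bsub>G\<^esub> b \<otimes>\<^bsub>G\<^esub> inv\<^bsub>G\<^esub> a \<otimes>\<^bsub>G\<^esub> inv\<^bsub>G\<^esub> b}"
  have Cc: "?C \<subseteq> carrier G" using AB by (auto intro!: G.m_closed G.inv_closed)
  have eq: "f a \<otimes>\<^bsub>H\<^esub> f b \<otimes>\<^bsub>H\<^esub> inv\<^bsub>H\<^esub> f a \<otimes>\<^bsub>H\<^esub> inv\<^bsub>H\<^esub> f b = f (a \<otimes>\<^bsub>G\<^esub> b \<otimes>\<^bsub>G\<^esub> inv\<^bsub>G\<^esub> a \<otimes>\<^bsub>G\<^esub> inv\<^bsub>G\<^esub> b)"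
    if "a \<in> A" "b \<in> B" for a b
    using that AB by (simp add: subset_iff)
  have "(\<Union>a\<in>f`A. \<Union>b\<in>f`B. {a \<otimes>\<^bsub>H\<^esub> b \<otimes>\<^bsub>H\<^esub> inv\<^bsub>H\<^esub> a \<otimes>\<^bsub>H\<^esub> inv\<^bsub>H\<^esub> b}) = f ` ?C"
    using eq by (simp add: image_UN)
  moreover have "generate H (f ` ?C) = f ` generate G ?C"
    using generate_img[OF Cc] .
  moreover have "T' closure_of (f ` generate G ?C) = f ` (T closure_of generate G ?C)"
  proof (rule equalityI)
    have "generate G ?C \<subseteq> topspace T" using G.generate_incl[OF Cc] top by simp
    then show "T' closure_of (f ` generate G ?C) \<subseteq> f ` (T closure_of generate G ?C)"
      using closed unfolding closed_map_closure_of_image by blast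
    show "f ` (T closure_of generate G ?C) \<subseteq> T' closure_of (f ` generate G ?C)"
      by (rule continuous_map_image_closure_subset[OF cont])
  qed
  ultimately show ?thesis
    unfolding closed_commutator_def by simp
qed

lemma lower_central_image:
  assumes hom: "group_hom G H f" and cont: "continuous_map T T' f" and closed: "closed_map T T' f"
    and T: "topological_group G T" and K: "subgroup K G" "closedin T K"
  shows "lower_central H T' i (f ` K) = f ` lower_central G T i K"
proof (induction i)
  case (Suc i)
  interpret topological_group G T by (rule T)
  have Kc: "K \<subseteq> carrier G" using K(1) subgroup.subset by blast
  then have Lc: "lower_central G T i K \<subseteq> carrier G"
    using lower_central_subset[OF K] by blast
  show ?case
    using Suc.IH closed_commutator_image[OF hom cont closed topspace_eq Lc Kc]
    by (cases i) simp_all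
qed simp

section \<open>Profinite groups and compactness\<close>

context profinite_group
begin

section \<open>Compactness, neighbourhoods of the identity and cosets\<close>

lemma compactin_closedin: "closedin T C \<Longrightarrow> compactin T C"
  by (rule closedin_compact_space[OF compact])

lemma closedin_set_mult:
  assumes "closedin T A" "closedin T B"
  shows "closedin T (A <#> B)"
proof -
  have "compactin (prod_topology T T) (A \<times> B)"
    using assms compactin_closedin by (simp add: compactin_Times)
  then have "compactin T ((\<lambda>(x, y). x \<otimes> y) ` (A \<times> B))"
    by (rule image_compactin[OF _ continuous_mult])
  moreover have "(\<lambda>(x, y). x \<otimes> y) ` (A \<times> B) = A <#> B"
    unfolding set_mult_def by auto
  ultimately show ?thesis
    using compactin_imp_closedin[OF Hausdorff] by simp
qed

lemma closedin_finite:
  assumes "finite S" "S \<subseteq> carrier G"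
  shows "closedin T S"
  using assms finite_imp_compactin[of S T] compactin_imp_closedin[OF Hausdorff] topspace_eq by simp

lemma closedin_one: "closedin T {\<one>}"
  by (rule closedin_finite) auto

text \<open>Tube lemma around \<open>K \<times> {\<one>}\<close>. It is applied to multiplication,
  to find an open subgroup, and to conjugation by the whole group, to find a normal one.\<close>

lemma one_open_tube:
  assumes cont: "continuous_map (prod_topology T T) T (\<lambda>p. f (fst p) (snd p))"
    and U: "openin T U" and K: "closedin T K" and one: "\<And>k. k \<in> K \<Longrightarrow> f k \<one> \<in> U"
  shows "\<exists>V. openin T V \<and> \<one> \<in> V \<and> (\<forall>k\<in>K. \<forall>v\<in>V. f k v \<in> U)"
proof -
  let ?W = "{p \<in> topspace (prod_topology T T). f (fst p) (snd p) \<in> U}"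
  have oW: "openin (prod_topology T T) ?W"
    by (rule openin_continuous_map_preimage[OF cont U])
  have sub: "K \<times> {\<one>} \<subseteq> ?W"
    using one closed_subset_carrier[OF K] by (auto simp: topspace_eq)
  have "compactin T {\<one>}" using closedin_one compactin_closedin by blast
  obtain A V where AV: "openin T V" "K \<subseteq> A" "{\<one>} \<subseteq> V" "A \<times> V \<subseteq> ?W"
    by (rule Wallace_theorem_prod_topology[OF compactin_closedin[OF K] \<open>compactin T {\<one>}\<close> oW sub])
  have "f k v \<in> U" if "k \<in> K" "v \<in> V" for k v
  proof -
    have "(k, v) \<in> ?W" using that AV(2,4) by blast
    then show ?thesis by simp
  qed
  then show ?thesis using AV by (intro exI[of _ V]) simp
qed

text \<open>Total disconnectedness and compactness give an open and closed \<open>U\<close> with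
  identity inside \<open>B\<close>; the right stabilizer of \<open>U\<close> is then an open
  subgroup inside \<open>U\<close>.\<close>

lemma open_subgroup_in_nbhd:
  assumes B: "openin T B" "\<one> \<in> B"
  obtains H where "subgroup H G" "openin T H" "H \<subseteq> B"
proof -
  have t1: "\<one> \<in> topspace T" by (simp add: topspace_eq)
  have "connected_component_of_set T \<one> = {\<one>}" by (rule totally_disconnected[OF t1])
  then have comp: "{\<one>} \<in> connected_components_of T"
    using connected_component_in_connected_components_of[of T \<one>] t1 by simp
  obtain U V where UV: "openin T U" "openin T V" "disjnt U V" "U \<union> V = topspace T" "{\<one>} \<subseteq> U" "U \<subseteq> B"
    using wilder_locally_compact_component_thm[OF compact_imp_locally_compact_space[OF compact]
        Hausdorff comp compactin_closedin[OF closedin_one] B(1)] B(2) by blast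
  have "U = topspace T - V" using UV(3,4) by (auto simp: disjnt_def)
  then have cU: "closedin T U" using closedin_diff[OF closedin_topspace UV(2)] by simp
  have Uc: "U \<subseteq> carrier G" by (rule open_subset_carrier[OF UV(1)])
  have "continuous_map (prod_topology T T) T (\<lambda>p. fst p \<otimes> snd p)"
    by (intro continuous_mult' continuous_map_fst continuous_map_snd)
  moreover have "k \<otimes> \<one> \<in> U" if "k \<in> U" for k using that Uc by auto
  ultimately obtain W where W: "openin T W" "\<one> \<in> W" "\<forall>k\<in>U. \<forall>v\<in>W. k \<otimes> v \<in> U"
    using one_open_tube[OF _ UV(1) cU, of "\<lambda>x y. x \<otimes> y"] by blast
  \<comment> \<open>Asking for stability under \<open>x\<close> and under \<open>inv x\<close> makes
    the set closed under inversion. It contains the symmetric neighbourhood built from the tube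
    \<open>W\<close>, and \<open>\<one> \<in> U\<close> places it inside \<open>U\<close>.\<close>
  let ?H = "{x \<in> carrier G. (\<forall>u\<in>U. u \<otimes> x \<in> U) \<and> (\<forall>u\<in>U. u \<otimes> inv x \<in> U)}"
  have H: "subgroup ?H G"
  proof (rule subgroupI)
    show "?H \<noteq> {}" using Uc by (auto intro!: exI[of _ \<one>] simp: subset_iff)
    fix a b assume ab: "a \<in> ?H" "b \<in> ?H"
    have "u \<otimes> (a \<otimes> b) \<in> U" if "u \<in> U" for u
    proof -
      have "u \<otimes> (a \<otimes> b) = (u \<otimes> a) \<otimes> b" using that ab Uc by (auto simp: m_assoc)
      then show ?thesis using that ab by simp
    qed
    moreover have "u \<otimes> inv (a \<otimes> b) \<in> U" if "u \<in> U" for u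
    proof -
      have "u \<otimes> inv (a \<otimes> b) = (u \<otimes> inv b) \<otimes> inv a"
        using that ab Uc by (auto simp: m_assoc inv_mult_group)
      then show ?thesis using that ab by simp
    qed
    ultimately show "a \<otimes> b \<in> ?H" using ab by simp
  qed auto
  have "W \<inter> {x \<in> carrier G. inv x \<in> W} \<subseteq> ?H"
    using W(3) open_subset_carrier[OF W(1)] by auto
  moreover have "openin T (W \<inter> {x \<in> carrier G. inv x \<in> W})"
    by (intro openin_Int W openin_preimage continuous_group_intros)
  moreover have "\<one> \<in> W \<inter> {x \<in> carrier G. inv x \<in> W}" using W(2) by simp
  ultimately have "openin T ?H" using openin_subgroup_superset[OF H] by blast
  moreover have "?H \<subseteq> B"
  proof
    fix x assume "x \<in> ?H"
    then have "x \<in> carrier G" "\<one> \<otimes> x \<in> U" using UV(5) by blast+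
    then show "x \<in> B" using UV(6) by auto
  qed
  ultimately show ?thesis using that H by blast
qed

text \<open>The normal core of an open subgroup \<open>H\<close> is open: the tube lemma over the
  compact set of all conjugating elements gives a neighbourhood of the identity all of whose
  conjugates lie in \<open>H\<close>.\<close>

lemma open_normal_in_nbhd:
  assumes B: "openin T B" "\<one> \<in> B"
  obtains N where "N \<lhd> G" "openin T N" "N \<subseteq> B"
proof -
  obtain H where H: "subgroup H G" "openin T H" "H \<subseteq> B"
    using open_subgroup_in_nbhd[OF B] .
  let ?N = "{x \<in> carrier G. \<forall>g\<in>carrier G. g \<otimes> x \<otimes> inv g \<in> H}"
  have cont: "continuous_map (prod_topology T T) T (\<lambda>p. fst p \<otimes> snd p \<otimes> inv fst p)"
    by (intro continuous_mult' continuous_inv' continuous_map_fst continuous_map_snd)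
  have "closedin T (carrier G)" using closedin_topspace[of T] by (simp add: topspace_eq)
  moreover have "g \<otimes> \<one> \<otimes> inv g \<in> H" if "g \<in> carrier G" for g
    using that subgroup.one_closed[OF H(1)] by simp
  ultimately obtain V where V: "openin T V" "\<one> \<in> V"
      "\<forall>g\<in>carrier G. \<forall>v\<in>V. g \<otimes> v \<otimes> inv g \<in> H"
    using one_open_tube[OF cont H(2), of "carrier G"] by blast
  have sN: "subgroup ?N G"
  proof (rule subgroupI)
    have "\<one> \<in> ?N" using subgroup.one_closed[OF H(1)] by simp
    then show "?N \<noteq> {}" by blast
    show "inv a \<in> ?N" if "a \<in> ?N" for a
      using that by (simp add: conj_inv subgroup.m_inv_closed[OF H(1)])
    show "a \<otimes> b \<in> ?N" if "a \<in> ?N" "b \<in> ?N" for a b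
    proof -
      have "g \<otimes> (a \<otimes> b) \<otimes> inv g \<in> H" if g: "g \<in> carrier G" for g
        using \<open>a \<in> ?N\<close> \<open>b \<in> ?N\<close> g
        by (subst conj_mult[OF g]) (auto intro: subgroup.m_closed[OF H(1)])
      then show ?thesis using that by simp
    qed
  qed auto
  have "g \<otimes> x \<otimes> inv g \<in> ?N" if g: "g \<in> carrier G" and x: "x \<in> ?N" for g x
  proof -
    have "h \<otimes> (g \<otimes> x \<otimes> inv g) \<otimes> inv h \<in> H" if h: "h \<in> carrier G" for h
    proof -
      have "h \<otimes> (g \<otimes> x \<otimes> inv g) \<otimes> inv h = (h \<otimes> g) \<otimes> x \<otimes> inv (h \<otimes> g)"
        using g h x by (simp add: m_assoc inv_mult_group)
      then show ?thesis using g h x by simp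
    qed
    then show ?thesis using g x by simp
  qed
  then have "?N \<lhd> G" unfolding normal_inv_iff using sN by blast
  moreover have "V \<subseteq> ?N" using V open_subset_carrier[OF V(1)] by blast
  then have "openin T ?N" using openin_subgroup_superset[OF sN V(1,2)] by blast
  moreover have "?N \<subseteq> B"
  proof
    fix x assume x: "x \<in> ?N"
    then have "\<one> \<otimes> x \<otimes> inv \<one> \<in> H" by blast
    then show "x \<in> B" using x H(3) by auto
  qed
  ultimately show ?thesis using that by blast
qed

lemma open_normal_avoiding:
  assumes "x \<in> carrier G" "x \<noteq> \<one>"
  obtains N where "N \<lhd> G" "openin T N" "x \<notin> N"
proof -
  have "openin T (carrier G - {x})"
    using closedin_finite[of "{x}"] assms by (simp add: closedin_def topspace_eq)
  then show ?thesis using open_normal_in_nbhd[of "carrier G - {x}"] assms that by blast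
qed

text \<open>A closed set is the intersection of its products with open normal subgroups. Here
  \<open>?B\<close> consists of the \<open>x\<close> for which \<open>q \<otimes> inv x\<close>
  avoids \<open>Y\<close>.\<close>

lemma open_normal_separating:
  assumes Y: "closedin T Y" and q: "q \<in> carrier G" "q \<notin> Y"
  obtains N where "N \<lhd> G" "openin T N" "q \<notin> Y <#> N"
proof -
  let ?B = "{x \<in> carrier G. q \<otimes> inv x \<in> carrier G - Y}"
  have "openin T (carrier G - Y)" using Y by (simp add: closedin_def topspace_eq)
  then have "openin T ?B" using q by (intro openin_preimage continuous_group_intros)
  moreover have "\<one> \<in> ?B" using q by simp
  ultimately obtain N where N: "N \<lhd> G" "openin T N" "N \<subseteq> ?B"
    using open_normal_in_nbhd by blast
  have "q \<notin> Y <#> N"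
  proof
    assume "q \<in> Y <#> N"
    then obtain y n where yn: "y \<in> Y" "n \<in> N" "q = y \<otimes> n" unfolding in_set_mult_iff by blast
    then have "y \<in> carrier G" "n \<in> carrier G" "q \<otimes> inv n \<notin> Y"
      using N(3) closed_subset_carrier[OF Y] by blast+
    then show False using yn by (simp add: m_assoc)
  qed
  then show ?thesis using that N by blast
qed

lemma openin_rcoset:
  assumes "subgroup U G" "openin T U" "a \<in> carrier G"
  shows "openin T (U #> a)"
proof -
  have "U #> a = {x \<in> carrier G. x \<otimes> inv a \<in> U}"
  proof (intro equalityI subsetI)
    fix x assume "x \<in> U #> a"
    then obtain u where "u \<in> U" "x = u \<otimes> a" by (auto simp: r_coset_def)
    then show "x \<in> {x \<in> carrier G. x \<otimes> inv a \<in> U}"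
      using assms(3) subgroup.mem_carrier[OF assms(1)] by (simp add: m_assoc)
  next
    fix x assume x: "x \<in> {x \<in> carrier G. x \<otimes> inv a \<in> U}"
    then have "x = (x \<otimes> inv a) \<otimes> a" using assms(3) by (simp add: m_assoc)
    then show "x \<in> U #> a" using x by (auto simp: r_coset_def)
  qed
  moreover have "openin T {x \<in> carrier G. x \<otimes> inv a \<in> U}"
    using assms(3) by (intro openin_preimage[OF _ assms(2)] continuous_group_intros) auto
  ultimately show ?thesis by simp
qed

text \<open>The cosets are a disjoint open cover of a compact space, so a finite subcover must
  contain every one of them.\<close>

lemma finite_rcosets:
  assumes U: "subgroup U G" "openin T U"
  shows "finite (rcosets U)"
proof -
  have "\<forall>C\<in>rcosets U. openin T C" unfolding RCOSETS_def using openin_rcoset[OF U] by blast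
  moreover have "topspace T \<subseteq> \<Union>(rcosets U)" using rcosets_part_G[OF U(1)] topspace_eq by simp
  moreover have "compactin T (topspace T)" using compact by (simp add: compact_space_def)
  ultimately obtain F where F: "finite F" "F \<subseteq> rcosets U" "topspace T \<subseteq> \<Union>F"
    unfolding compactin_def by meson
  have "rcosets U \<subseteq> F"
  proof
    fix C assume C: "C \<in> rcosets U"
    then obtain a where a: "a \<in> carrier G" "C = U #> a" unfolding RCOSETS_def by blast
    then have aC: "a \<in> C" using rcos_self[OF _ U(1)] by simp
    obtain D where D: "D \<in> F" "a \<in> D" using F(3) a topspace_eq by blast
    have "C = D"
      using rcos_disjoint[OF U(1)] C D F(2) aC unfolding pairwise_def disjnt_def by blast
    then show "C \<in> F" using D by simp
  qed
  then show ?thesis using F(1) finite_subset by blast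
qed

lemma subgroup_eq_Union_rcosets:
  assumes U: "subgroup U G" and M: "subgroup M G" "U \<subseteq> M"
  shows "M = \<Union>{C \<in> rcosets U. C \<subseteq> M}"
proof (intro equalityI subsetI)
  fix x assume x: "x \<in> M"
  then have xc: "x \<in> carrier G" using subgroup.mem_carrier[OF M(1)] by blast
  have "U #> x \<subseteq> M" using x M(2) by (auto simp: r_coset_def intro!: subgroup.m_closed[OF M(1)])
  moreover have "U #> x \<in> rcosets U" using xc by (auto simp: RCOSETS_def)
  ultimately show "x \<in> \<Union>{C \<in> rcosets U. C \<subseteq> M}" using rcos_self[OF xc U] by blast
qed blast

text \<open>Each such subgroup is the union of the cosets of \<open>U\<close> inside it, and there
  are finitely many cosets.\<close>

lemma finite_subgroups_above:
  assumes U: "subgroup U G" "openin T U"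
  shows "finite {M. subgroup M G \<and> U \<subseteq> M}"
proof (rule finite_subset)
  show "{M. subgroup M G \<and> U \<subseteq> M} \<subseteq> Union ` Pow (rcosets U)"
    using subgroup_eq_Union_rcosets[OF U(1)] by blast
qed (use finite_rcosets[OF U] in simp)

lemma profinite_closed_subgroup:
  assumes M: "subgroup M G" "closedin T M"
  shows "profinite_group (G\<lparr>carrier := M\<rparr>) (subtopology T M)"
proof -
  interpret M: group "G\<lparr>carrier := M\<rparr>" by (rule subgroup_imp_group[OF M(1)])
  have Mc: "M \<subseteq> carrier G" by (rule subgroup.subset[OF M(1)])
  have top: "topspace (subtopology T M) = M" using Mc by (auto simp: topspace_eq)
  show ?thesis
  proof (intro profinite_group.intro topological_group.intro topological_group_axioms.intro
      profinite_group_axioms.intro M.group_axioms)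
    show "topspace (subtopology T M) = carrier (G\<lparr>carrier := M\<rparr>)" using top by simp
    have "continuous_map (subtopology (prod_topology T T) (M \<times> M)) T (\<lambda>(x, y). x \<otimes> y)"
      by (rule continuous_map_from_subtopology[OF continuous_mult])
    then have "continuous_map (prod_topology (subtopology T M) (subtopology T M)) (subtopology T M) (\<lambda>(x, y). x \<otimes> y)"
      unfolding continuous_map_in_subtopology subtopology_Times
      using top by (auto intro: subgroup.m_closed[OF M(1)])
    then show "continuous_map (prod_topology (subtopology T M) (subtopology T M)) (subtopology T M)
        (\<lambda>(x, y). x \<otimes>\<^bsub>G\<lparr>carrier := M\<rparr>\<^esub> y)" by simp
    have "continuous_map (subtopology T M) (subtopology T M) (\<lambda>x. inv x)"
      unfolding continuous_map_in_subtopology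
      using top continuous_map_from_subtopology[OF continuous_inv]
      by (auto intro: subgroup.m_inv_closed[OF M(1)])
    then show "continuous_map (subtopology T M) (subtopology T M) (\<lambda>x. inv\<^bsub>G\<lparr>carrier := M\<rparr>\<^esub> x)"
      by (rule continuous_map_eq) (use top m_inv_consistent[OF M(1)] in simp)
    show "compact_space (subtopology T M)"
      by (rule compact_space_subtopology[OF compactin_closedin[OF M(2)]])
    show "Hausdorff_space (subtopology T M)" by (rule Hausdorff_space_subtopology[OF Hausdorff])
    fix x assume x: "x \<in> topspace (subtopology T M)"
    then have "x \<in> topspace T" "x \<in> M" using top by auto
    \<comment> \<open>The component of \<open>x\<close> in \<open>G\<close> is a single point, hence
      lies in \<open>M\<close>, and therefore is also the component in the subspace.\<close>
    then have "connected_component_of_set T x \<subseteq> M" using totally_disconnected[of x] by simp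
    then have "connected_component_of (subtopology T M) x = connected_component_of T x"
      unfolding connected_component_of_subtopology_eq .
    then show "connected_component_of_set (subtopology T M) x = {x}"
      using totally_disconnected[OF \<open>x \<in> topspace T\<close>] by simp
  qed
qed

text \<open>Finite intersection property: by directedness every finite subfamily has a member of the
  family below its intersection, and that member meets \<open>K\<close>.\<close>

lemma directed_Inter_meets:
  assumes ne: "\<C> \<noteq> {}" and cl: "\<And>C. C \<in> \<C> \<Longrightarrow> closedin T C"
    and dir: "\<And>C D. C \<in> \<C> \<Longrightarrow> D \<in> \<C> \<Longrightarrow> \<exists>E\<in>\<C>. E \<subseteq> C \<inter> D"
    and K: "closedin T K" and meet: "\<And>C. C \<in> \<C> \<Longrightarrow> C \<inter> K \<noteq> {}"
  shows "\<Inter>\<C> \<inter> K \<noteq> {}"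
proof -
  have below: "\<exists>E\<in>\<C>. E \<subseteq> \<Inter>\<F>" if "finite \<F>" "\<F> \<subseteq> \<C>" for \<F>
    using that
  proof (induction \<F>)
    case (insert C \<F>)
    then obtain E where E: "E \<in> \<C>" "E \<subseteq> \<Inter>\<F>" by auto
    have "C \<in> \<C>" using insert.prems by simp
    then obtain E' where "E' \<in> \<C>" "E' \<subseteq> C \<inter> E" using dir E(1) by blast
    then show ?case using E(2) by (intro bexI[of _ E']) auto
  qed (use ne in auto)
  let ?\<U> = "(\<lambda>C. C \<inter> K) ` \<C>"
  have "\<Inter>?\<U> \<noteq> {}"
  proof -
    have 1: "\<forall>C\<in>?\<U>. closedin T C" using closedin_Int[OF cl K] by blast
    have 2: "\<Inter>\<F> \<noteq> {}" if F: "finite \<F>" "\<F> \<subseteq> ?\<U>" for \<F>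
    proof -
      obtain \<F>' where F': "finite \<F>'" "\<F>' \<subseteq> \<C>" "\<F> = (\<lambda>C. C \<inter> K) ` \<F>'"
        using finite_subset_image[OF F] by blast
      obtain E where "E \<in> \<C>" "E \<subseteq> \<Inter>\<F>'" using below[OF F'(1,2)] by blast
      then have "E \<inter> K \<noteq> {}" "E \<inter> K \<subseteq> \<Inter>\<F>" using meet F'(3) by auto
      then show ?thesis by blast
    qed
    show ?thesis
      by (rule compact_space_fip[THEN iffD1, OF compact, THEN spec, THEN mp],
          rule conjI[OF 1], intro allI impI 2) simp_all
  qed
  moreover have "\<Inter>?\<U> \<subseteq> \<Inter>\<C> \<inter> K" using ne by blast
  ultimately show ?thesis by blast
qed

lemma directed_Inter_subset_open:
  assumes "\<C> \<noteq> {}" "\<And>C. C \<in> \<C> \<Longrightarrow> closedin T C"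
    and "\<And>C D. C \<in> \<C> \<Longrightarrow> D \<in> \<C> \<Longrightarrow> \<exists>E\<in>\<C>. E \<subseteq> C \<inter> D"
    and B: "openin T B" "\<Inter>\<C> \<subseteq> B"
  shows "\<exists>C\<in>\<C>. C \<subseteq> B"
proof (rule ccontr)
  assume "\<not> ?thesis"
  then have "C \<inter> (topspace T - B) \<noteq> {}" if "C \<in> \<C>" for C
    using that assms(2) closedin_subset by blast
  then have "\<Inter>\<C> \<inter> (topspace T - B) \<noteq> {}"
    by (intro directed_Inter_meets[OF assms(1,2,3) closedin_diff[OF closedin_topspace B(1)]])
  then show False using B(2) by blast
qed

text \<open>Zorn's lemma for unions of chains, carried over to intersections by taking
  complements.\<close>

lemma minimal_exists:
  assumes ne: "\<A> \<noteq> {}"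
    and chain: "\<And>\<C>. \<C> \<noteq> {} \<Longrightarrow> \<C> \<subseteq> \<A> \<Longrightarrow> (\<And>C D. C \<in> \<C> \<Longrightarrow> D \<in> \<C> \<Longrightarrow> C \<subseteq> D \<or> D \<subseteq> C) \<Longrightarrow> \<Inter>\<C> \<in> \<A>"
  obtains M where "M \<in> \<A>" "\<And>Y. Y \<in> \<A> \<Longrightarrow> Y \<subseteq> M \<Longrightarrow> Y = M"
proof -
  have "\<exists>M\<in>uminus ` \<A>. \<forall>Y\<in>uminus ` \<A>. M \<subseteq> Y \<longrightarrow> Y = M"
  proof (rule subset_Zorn_nonempty)
    show "uminus ` \<A> \<noteq> {}" using ne by simp
    fix \<C> assume C: "\<C> \<noteq> {}" "subset.chain (uminus ` \<A>) \<C>"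
    have sub: "uminus ` \<C> \<subseteq> \<A>" using C(2) by (auto simp: subset_chain_def)
    have "\<Inter>(uminus ` \<C>) \<in> \<A>"
    proof (rule chain)
      show "uminus ` \<C> \<noteq> {}" "uminus ` \<C> \<subseteq> \<A>" using C(1) sub by auto
      fix C D assume "C \<in> uminus ` \<C>" "D \<in> uminus ` \<C>"
      then show "C \<subseteq> D \<or> D \<subseteq> C" using C(2) unfolding subset_chain_def by blast
    qed
    moreover have "\<Union>\<C> = - \<Inter>(uminus ` \<C>)" by auto
    ultimately show "\<Union>\<C> \<in> uminus ` \<A>" by blast
  qed
  then obtain M where M: "M \<in> \<A>" "\<forall>Y\<in>uminus ` \<A>. - M \<subseteq> Y \<longrightarrow> Y = - M" by blast
  show ?thesis
  proof (rule that[OF M(1)])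
    fix Y assume "Y \<in> \<A>" "Y \<subseteq> M"
    then have "- Y \<in> uminus ` \<A>" "- M \<subseteq> - Y" by auto
    then have "- Y = - M" using M(2)[rule_format, of "- Y"] by simp
    then show "Y = M" by simp
  qed
qed

text \<open>The points outside the image of \<open>C\<close>, pulled back to \<open>G\<close>, form
  the complement of \<open>N <#> C\<close>, and that product of closed sets is closed by
  compactness.\<close>

lemma closed_map_coset:
  assumes N: "N \<lhd> G" "closedin T N"
  shows "closed_map T (coset_topology G T N) (\<lambda>x. N #> x)"
  unfolding closed_map_def
proof (intro allI impI)
  fix C assume C: "closedin T C"
  have sN: "subgroup N G" using N(1) by (rule normal_imp_subgroup)
  have Cc: "C \<subseteq> carrier G" by (rule closed_subset_carrier[OF C])
  let ?Q = "carrier (G Mod N)" and ?D = "(\<lambda>x. N #> x) ` C"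
  have Q: "?Q = rcosets N" by (simp add: FactGroup_def)
  have DQ: "?D \<subseteq> ?Q" using Cc unfolding Q by (auto simp: RCOSETS_def)
  have "\<Union>(?Q - ?D) = carrier G - (N <#> C)"
  proof (intro equalityI subsetI)
    fix x assume "x \<in> \<Union>(?Q - ?D)"
    then obtain E where E: "E \<in> rcosets N" "E \<notin> ?D" "x \<in> E" unfolding Q by blast
    have xc: "x \<in> carrier G" using E rcosets_part_G[OF sN] by blast
    have "x \<notin> N <#> C"
    proof
      assume "x \<in> N <#> C"
      then obtain n c where nc: "n \<in> N" "c \<in> C" "x = n \<otimes> c" unfolding in_set_mult_iff by blast
      then have "x \<in> N #> c" by (auto simp: r_coset_def)
      moreover have "N #> c \<in> rcosets N" using nc Cc by (auto simp: RCOSETS_def)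
      ultimately have "E = N #> c"
        using rcos_disjoint[OF sN] E unfolding pairwise_def disjnt_def by blast
      then show False using E(2) nc(2) by blast
    qed
    then show "x \<in> carrier G - (N <#> C)" using xc by blast
  next
    fix x assume x: "x \<in> carrier G - (N <#> C)"
    then have "N #> x \<in> rcosets N" by (auto simp: RCOSETS_def)
    moreover have "N #> x \<notin> ?D"
    proof
      assume "N #> x \<in> ?D"
      then obtain c where c: "c \<in> C" "N #> x = N #> c" by blast
      then have "x \<in> N #> c" using rcos_self[OF _ sN, of x] x by simp
      then obtain n where "n \<in> N" "x = n \<otimes> c" by (auto simp: r_coset_def)
      then have "x \<in> N <#> C" using c(1) unfolding in_set_mult_iff by blast
      then show False using x by blast
    qed
    ultimately show "x \<in> \<Union>(?Q - ?D)" unfolding Q using rcos_self[OF _ sN, of x] x by blast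
  qed
  moreover have "openin T (carrier G - (N <#> C))"
    using closedin_set_mult[OF N(2) C] by (simp add: closedin_def topspace_eq)
  ultimately show "closedin (coset_topology G T N) ?D"
    unfolding closedin_def topspace_coset_topology[OF N(1)] openin_coset_topology[OF N(1)]
    using DQ by auto
qed

lemma lower_central_quotient:
  assumes N: "N \<lhd> G" "closedin T N" and K: "subgroup K G" "closedin T K"
  shows "lower_central (G Mod N) (coset_topology G T N) i ((\<lambda>x. N #> x) ` K) =
    (\<lambda>x. N #> x) ` lower_central G T i K"
proof (rule lower_central_image[OF _ continuous_coset_map[OF N(1)] closed_map_coset[OF N] _ K])
  show "group_hom G (G Mod N) (\<lambda>x. N #> x)"
    using N(1) normal.r_coset_hom_Mod normal.factorgroup_is_group is_group
    by (intro group_hom.intro group_hom_axioms.intro) auto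
  show "topological_group G T" by (rule topological_group_axioms)
qed

text \<open>This removes factor groups: the series commutes with the projection, and open subgroups
  of the quotient and of \<open>G\<close> correspond by preimage and image.\<close>

lemma virtually_nilpotent_quotient_iff:
  assumes N: "N \<lhd> G" "closedin T N"
  shows "virtually_nilpotent_of_class c (G Mod N) (coset_topology G T N) \<longleftrightarrow>
    (\<exists>H. open_subgroup G T H \<and> lower_central G T (c + 1) H \<subseteq> N)"
proof -
  let ?f = "\<lambda>x. N #> x" and ?T = "coset_topology G T N"
  have sN: "subgroup N G" using N(1) by (rule normal_imp_subgroup)
  interpret f: group_hom G "G Mod N" ?f
    using N(1) normal.r_coset_hom_Mod normal.factorgroup_is_group is_group
    by (intro group_hom.intro group_hom_axioms.intro) auto
  have key: "lower_central (G Mod N) ?T (c + 1) (?f ` H) = {\<one>\<^bsub>G Mod N\<^esub>} \<longleftrightarrow>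
      lower_central G T (c + 1) H \<subseteq> N" if H: "subgroup H G" "openin T H" for H
  proof -
    have cH: "closedin T H" by (rule open_subgroup_closed[OF H])
    let ?L = "lower_central G T (c + 1) H"
    have L: "\<one> \<in> ?L" "?L \<subseteq> carrier G"
      using lower_central_subgroup[OF H(1) cH, of "c+1"] subgroup.one_closed subgroup.subset by blast+
    have "?f ` ?L = {N} \<longleftrightarrow> ?L \<subseteq> N"
    proof
      assume eq: "?f ` ?L = {N}"
      show "?L \<subseteq> N"
      proof
        fix x assume x: "x \<in> ?L"
        then have "N #> x = N" using eq by blast
        then show "x \<in> N" using rcos_self[OF _ sN, of x] x L(2) by auto
      qed
    next
      assume "?L \<subseteq> N"
      then have "N #> x = N" if "x \<in> ?L" for x
        using that coset_join2[OF _ sN] L(2) by blast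
      then show "?f ` ?L = {N}" using L(1) by auto
    qed
    then show ?thesis unfolding lower_central_quotient[OF N H(1) cH] by (simp add: FactGroup_def)
  qed
  show ?thesis
  proof
    assume "virtually_nilpotent_of_class c (G Mod N) ?T"
    then obtain Q where Q: "subgroup Q (G Mod N)" "openin ?T Q"
        "lower_central (G Mod N) ?T (c + 1) Q = {\<one>\<^bsub>G Mod N\<^esub>}"
      unfolding virtually_nilpotent_of_class_def open_subgroup_def by blast
    let ?H = "{x \<in> carrier G. ?f x \<in> Q}"
    have Qsub: "Q \<subseteq> rcosets N" using subgroup.subset[OF Q(1)] by (simp add: FactGroup_def)
    have H: "subgroup ?H G"
    proof (rule subgroupI)
      have "\<one> \<in> ?H" using subgroup.one_closed[OF Q(1)] f.hom_one by simp
      then show "?H \<noteq> {}" by blast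
      show "inv a \<in> ?H" if "a \<in> ?H" for a
        using that subgroup.m_inv_closed[OF Q(1), of "?f a"] by simp
      show "a \<otimes> b \<in> ?H" if "a \<in> ?H" "b \<in> ?H" for a b
        using that subgroup.m_closed[OF Q(1), of "?f a" "?f b"] f.hom_mult[of a b] by auto
    qed auto
    moreover have "openin T ?H"
      using openin_continuous_map_preimage[OF continuous_coset_map[OF N(1)] Q(2)]
      by (simp add: topspace_eq)
    moreover have "?f ` ?H = Q" using Qsub by (auto simp: RCOSETS_def)
    ultimately show "\<exists>H. open_subgroup G T H \<and> lower_central G T (c + 1) H \<subseteq> N"
      using key[of ?H] Q(3) unfolding open_subgroup_def by metis
  next
    assume "\<exists>H. open_subgroup G T H \<and> lower_central G T (c + 1) H \<subseteq> N"
    then obtain H where H: "subgroup H G" "openin T H" "lower_central G T (c + 1) H \<subseteq> N"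
      unfolding open_subgroup_def by blast
    have Hc: "H \<subseteq> carrier G" by (rule subgroup.subset[OF H(1)])
    \<comment> \<open>The image of \<open>H\<close> is open in the quotient because the union of its
      cosets is a product with an open factor.\<close>
    have "\<Union>(?f ` H) = N <#> H"
      unfolding set_mult_def r_coset_def by auto
    moreover have "openin T (N <#> H)"
      by (rule openin_set_mult[OF H(2) subgroup.subset[OF sN]])
    ultimately have "openin ?T (?f ` H)"
      unfolding openin_coset_topology[OF N(1)] using Hc by (auto simp: FactGroup_def RCOSETS_def)
    moreover have "subgroup (?f ` H) (G Mod N)" by (rule f.subgroup_img_is_subgroup[OF H(1)])
    ultimately show "virtually_nilpotent_of_class c (G Mod N) ?T"
      unfolding virtually_nilpotent_of_class_def open_subgroup_def using key[OF H(1,2)] H(3) by blast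
  qed
qed

end

section \<open>Centralizers and Fitting-free groups\<close>

definition centralizer :: "('a, 'b) monoid_scheme \<Rightarrow> 'a set \<Rightarrow> 'a set" where
  "centralizer G S = {x \<in> carrier G. \<forall>s\<in>S. x \<otimes>\<^bsub>G\<^esub> s = s \<otimes>\<^bsub>G\<^esub> x}"

context group
begin

lemma commutator_eq_one_iff:
  assumes "x \<in> carrier G" "y \<in> carrier G"
  shows "x \<otimes> y \<otimes> inv x \<otimes> inv y = \<one> \<longleftrightarrow> x \<otimes> y = y \<otimes> x"
proof
  assume "x \<otimes> y \<otimes> inv x \<otimes> inv y = \<one>"
  then have "x \<otimes> y \<otimes> inv x = y"
    using assms inv_equality[of "x \<otimes> y \<otimes> inv x" "inv y"] by simp
  then have "x \<otimes> y \<otimes> inv x \<otimes> x = y \<otimes> x" by simp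
  then show "x \<otimes> y = y \<otimes> x" using assms by (simp add: m_assoc)
next
  assume "x \<otimes> y = y \<otimes> x"
  then have "x \<otimes> y \<otimes> inv x \<otimes> inv y = y \<otimes> x \<otimes> inv x \<otimes> inv y" by simp
  then show "x \<otimes> y \<otimes> inv x \<otimes> inv y = \<one>" using assms by (simp add: m_assoc)
qed

lemma subgroup_centralizer:
  assumes S: "S \<subseteq> carrier G"
  shows "subgroup (centralizer G S) G"
proof (rule subgroupI)
  show "centralizer G S \<subseteq> carrier G" by (auto simp: centralizer_def)
  have "\<one> \<in> centralizer G S" using S by (auto simp: centralizer_def)
  then show "centralizer G S \<noteq> {}" by blast
next
  fix x assume x: "x \<in> centralizer G S"
  then have xc: "x \<in> carrier G" by (simp add: centralizer_def)
  have "inv x \<otimes> s = s \<otimes> inv x" if s: "s \<in> S" for s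
  proof -
    have sc: "s \<in> carrier G" using s S by blast
    have "inv x \<otimes> (x \<otimes> s) \<otimes> inv x = inv x \<otimes> (s \<otimes> x) \<otimes> inv x"
      using x s by (simp add: centralizer_def)
    moreover have "inv x \<otimes> (x \<otimes> s) = s" using xc sc by (simp flip: m_assoc)
    ultimately show ?thesis using xc sc by (simp add: m_assoc)
  qed
  then show "inv x \<in> centralizer G S" using xc by (simp add: centralizer_def)
  fix y assume y: "y \<in> centralizer G S"
  then have yc: "y \<in> carrier G" by (simp add: centralizer_def)
  have "x \<otimes> y \<otimes> s = s \<otimes> (x \<otimes> y)" if s: "s \<in> S" for s
  proof -
    have sc: "s \<in> carrier G" using s S by blast
    have "x \<otimes> y \<otimes> s = x \<otimes> (s \<otimes> y)" using y s xc yc sc by (simp add: m_assoc centralizer_def)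
    also have "\<dots> = (s \<otimes> x) \<otimes> y" using x s xc yc sc by (simp add: centralizer_def flip: m_assoc)
    finally show ?thesis using xc yc sc by (simp add: m_assoc)
  qed
  then show "x \<otimes> y \<in> centralizer G S" using xc yc by (simp add: centralizer_def)
qed

lemma normal_centralizer:
  assumes S: "S \<subseteq> carrier G" and conj: "\<And>g s. g \<in> carrier G \<Longrightarrow> s \<in> S \<Longrightarrow> g \<otimes> s \<otimes> inv g \<in> S"
  shows "centralizer G S \<lhd> G"
proof -
  have "g \<otimes> x \<otimes> inv g \<in> centralizer G S" if g: "g \<in> carrier G" and x: "x \<in> centralizer G S" for g x
  proof -
    have xc: "x \<in> carrier G" using x by (simp add: centralizer_def)
    have "(g \<otimes> x \<otimes> inv g) \<otimes> s = s \<otimes> (g \<otimes> x \<otimes> inv g)" if s: "s \<in> S" for s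
    proof -
      have sc: "s \<in> carrier G" using s S by blast
      let ?s = "inv g \<otimes> s \<otimes> g"
      have "?s \<in> S" using conj[of "inv g" s] g s by simp
      then have "x \<otimes> ?s = ?s \<otimes> x" using x by (simp add: centralizer_def)
      then have "g \<otimes> (x \<otimes> ?s) \<otimes> inv g = g \<otimes> (?s \<otimes> x) \<otimes> inv g" by simp
      moreover have "g \<otimes> ?s \<otimes> inv g = s"
      proof -
        have "g \<otimes> (inv g \<otimes> s) = s" using g sc by (simp flip: m_assoc)
        then show ?thesis using g sc by (simp add: m_assoc)
      qed
      ultimately show ?thesis using g xc sc conj_mult[OF g xc, of ?s] conj_mult[OF g, of ?s x] by simp
    qed
    then show ?thesis using g xc by (simp add: centralizer_def)
  qed
  then show ?thesis unfolding normal_inv_iff using subgroup_centralizer[OF S] by blast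
qed

lemma comm_group_subgroupI:
  assumes "subgroup A G" "\<And>x y. x \<in> A \<Longrightarrow> y \<in> A \<Longrightarrow> x \<otimes> y = y \<otimes> x"
  shows "comm_group (G\<lparr>carrier := A\<rparr>)"
  using group.group_comm_groupI[OF subgroup_imp_group[OF assms(1)]] assms(2) by simp

end

context profinite_group
begin

lemma closedin_centralizer:
  assumes S: "S \<subseteq> carrier G"
  shows "closedin T (centralizer G S)"
proof -
  let ?F = "\<lambda>s. {x \<in> carrier G. x \<otimes> s \<otimes> inv x \<otimes> inv s \<in> {\<one>}}"
  \<comment> \<open>\<open>carrier G\<close> is inserted so that the intersection is over a
    non-empty family even when \<open>S\<close> is empty.\<close>
  have eq: "centralizer G S = \<Inter>(insert (carrier G) (?F ` S))"
    using commutator_eq_one_iff S unfolding centralizer_def by (auto simp: subset_iff)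
  have F: "closedin T (?F s)" if "s \<in> S" for s
    using that S by (intro closedin_preimage closedin_one continuous_group_intros) auto
  have "closedin T (carrier G)" using closedin_topspace[of T] by (simp add: topspace_eq)
  then have "closedin T C" if "C \<in> insert (carrier G) (?F ` S)" for C
    using that F by blast
  then show ?thesis unfolding eq by (intro closedin_Inter) auto
qed

section \<open>Consequences of having no abelian closed normal subgroups\<close>

lemma fitting_freeD:
  assumes "fitting_free G T" "A \<lhd> G" "closedin T A" "\<And>x y. x \<in> A \<Longrightarrow> y \<in> A \<Longrightarrow> x \<otimes> y = y \<otimes> x"
  shows "A = {\<one>}"
  using assms comm_group_subgroupI[OF normal_imp_subgroup[OF assms(2)]] unfolding fitting_free_def by blast

text \<open>If the next term were trivial, the current one would be central in \<open>R\<close>,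
  hence abelian, closed and normal in \<open>G\<close>, hence already trivial.\<close>

lemma lower_central_nontrivial:
  assumes ff: "fitting_free G T" and R: "R \<lhd> G" "closedin T R" "R \<noteq> {\<one>}"
  shows "lower_central G T (Suc i) R \<noteq> {\<one>}"
proof (induction i)
  case (Suc i)
  let ?L = "lower_central G T (Suc i) R"
  have sR: "subgroup R G" using R(1) by (rule normal_imp_subgroup)
  have Rc: "R \<subseteq> carrier G" by (rule subgroup.subset[OF sR])
  have LR: "?L \<subseteq> R" by (rule lower_central_subset[OF sR R(2)])
  show ?case
  proof
    assume triv: "lower_central G T (Suc (Suc i)) R = {\<one>}"
    have "?L = {\<one>}"
    proof (rule fitting_freeD[OF ff lower_central_normal[OF R(1,2)] lower_central_closedin[OF sR R(2)]])
      fix x y assume xy: "x \<in> ?L" "y \<in> ?L"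
      then have "x \<otimes> y \<otimes> inv x \<otimes> inv y \<in> closed_commutator G T ?L R"
        using LR Rc by (intro commutator_in_closed_commutator) auto
      then have "x \<otimes> y \<otimes> inv x \<otimes> inv y = \<one>" using triv by simp
      then show "x \<otimes> y = y \<otimes> x"
        using xy LR Rc commutator_eq_one_iff[of x y] by blast
    qed
    then show False using Suc.IH by simp
  qed
qed (use R in simp)

text \<open>The centre of the subgroup generated by all conjugates of \<open>A\<close> is abelian and normal in \<open>G\<close>;
  it contains any intersection of conjugates of \<open>A\<close> that is minimal among the non-trivial ones.\<close>

lemma fitting_free_abelian_normal_in_open:
  assumes ff: "fitting_free G T" and M: "M \<lhd> G" "openin T M"
    and A: "subgroup A G" "A \<subseteq> M" and conj: "\<And>m a. m \<in> M \<Longrightarrow> a \<in> A \<Longrightarrow> m \<otimes> a \<otimes> inv m \<in> A"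
    and comm: "\<And>x y. x \<in> A \<Longrightarrow> y \<in> A \<Longrightarrow> x \<otimes> y = y \<otimes> x"
  shows "A = {\<one>}"
proof (rule ccontr)
  assume nontriv: "A \<noteq> {\<one>}"
  have sM: "subgroup M G" using M(1) by (rule normal_imp_subgroup)
  have Ac: "A \<subseteq> carrier G" by (rule subgroup.subset[OF A(1)])
  have Mc: "M \<subseteq> carrier G" by (rule subgroup.subset[OF sM])
  define cj where "cj g = (\<lambda>x. g \<otimes> x \<otimes> inv g) ` A" for g
  let ?C = "cj ` carrier G"
  have cj_iff: "x \<in> cj g \<longleftrightarrow> inv g \<otimes> x \<otimes> g \<in> A" if g: "g \<in> carrier G" and x: "x \<in> carrier G" for g x
  proof
    assume "x \<in> cj g"
    then obtain a where a: "a \<in> A" "x = g \<otimes> a \<otimes> inv g" unfolding cj_def by blast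
    then have ac: "a \<in> carrier G" using Ac by blast
    have "inv g \<otimes> (g \<otimes> a) = a" using g ac by (simp flip: m_assoc)
    then have "inv g \<otimes> x \<otimes> g = a" using a g ac by (simp add: m_assoc)
    then show "inv g \<otimes> x \<otimes> g \<in> A" using a by simp
  next
    assume a: "inv g \<otimes> x \<otimes> g \<in> A"
    have "g \<otimes> (inv g \<otimes> x) = x" using g x by (simp flip: m_assoc)
    then have "x = g \<otimes> (inv g \<otimes> x \<otimes> g) \<otimes> inv g" using g x by (simp add: m_assoc)
    then show "x \<in> cj g" using a unfolding cj_def by blast
  qed
  have cj_sub: "cj g \<subseteq> M" if g: "g \<in> carrier G" for g
    using normal_conj[OF M(1) g] A(2) unfolding cj_def by blast
  have cj_conj: "h \<otimes> x \<otimes> inv h \<in> cj (h \<otimes> g)" if g: "g \<in> carrier G" and h: "h \<in> carrier G" and x: "x \<in> cj g" for g h x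
  proof -
    obtain a where a: "a \<in> A" "x = g \<otimes> a \<otimes> inv g" using x unfolding cj_def by blast
    then have "h \<otimes> x \<otimes> inv h = (h \<otimes> g) \<otimes> a \<otimes> inv (h \<otimes> g)"
      using g h Ac by (simp add: m_assoc inv_mult_group subset_iff)
    then show ?thesis using a unfolding cj_def by blast
  qed
  \<comment> \<open>As \<open>M\<close> is normal, \<open>m \<otimes> g\<close> is \<open>g\<close>
    times an element of \<open>M\<close>, and that element normalizes \<open>A\<close>. So a
    conjugate of \<open>A\<close> depends only on the coset of \<open>M\<close>, which makes the
    conjugates finite in number and each of them normalized by \<open>M\<close>.\<close>
  have cj_M: "cj (m \<otimes> g) = cj g" if m: "m \<in> M" and g: "g \<in> carrier G" for m g
  proof -
    have mc: "m \<in> carrier G" using m Mc by blast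
    let ?n = "inv g \<otimes> m \<otimes> g"
    have nM: "?n \<in> M" by (rule normal.inv_op_closed1[OF M(1) g m])
    have nc: "?n \<in> carrier G" using g mc by simp
    have inM: "inv ?n \<in> M" by (rule subgroup.m_inv_closed[OF sM nM])
    have "g \<otimes> (inv g \<otimes> (m \<otimes> g)) = m \<otimes> g" using g mc by (simp flip: m_assoc)
    then have mg: "m \<otimes> g = g \<otimes> ?n" using g mc by (simp add: m_assoc)
    have cA: "(?n \<otimes> a \<otimes> inv ?n \<in> A) = (a \<in> A)" if a: "a \<in> carrier G" for a
    proof
      assume "?n \<otimes> a \<otimes> inv ?n \<in> A"
      from conj[OF inM this] have "inv ?n \<otimes> (?n \<otimes> a \<otimes> inv ?n) \<otimes> ?n \<in> A" using nc by simp
      moreover have "inv ?n \<otimes> (?n \<otimes> a) = a" using nc a by (simp flip: m_assoc)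
      then have "inv ?n \<otimes> (?n \<otimes> a \<otimes> inv ?n) \<otimes> ?n = a" using nc a
        by (simp only: m_assoc[of ?n] m_assoc[of "inv ?n"] m_assoc[of a] m_closed inv_closed l_inv r_one)
      ultimately show "a \<in> A" by simp
    qed (rule conj[OF nM])
    show ?thesis
    proof (intro equalityI subsetI)
      fix x assume "x \<in> cj (m \<otimes> g)"
      then obtain a where a: "a \<in> A" "x = (g \<otimes> ?n) \<otimes> a \<otimes> inv (g \<otimes> ?n)" unfolding cj_def mg by blast
      have ac: "a \<in> carrier G" using a Ac by blast
      have "x = g \<otimes> (?n \<otimes> a \<otimes> inv ?n) \<otimes> inv g"
        unfolding a(2) using g nc ac by (simp only: inv_mult_group[OF g nc] m_assoc m_closed inv_closed)
      then show "x \<in> cj g" using conj[OF nM a(1)] unfolding cj_def by blast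
    next
      fix x assume "x \<in> cj g"
      then obtain a where a: "a \<in> A" "x = g \<otimes> a \<otimes> inv g" unfolding cj_def by blast
      have ac: "a \<in> carrier G" using a Ac by blast
      let ?a = "inv ?n \<otimes> a \<otimes> ?n"
      have aA: "?a \<in> A" using conj[OF inM a(1)] nc by simp
      have "?n \<otimes> (inv ?n \<otimes> a) = a" using nc ac by (simp flip: m_assoc)
      then have "a = ?n \<otimes> ?a \<otimes> inv ?n" using nc ac
        by (simp only: m_assoc[of ?n] m_assoc[of "inv ?n"] m_assoc[of a] m_closed inv_closed r_inv r_one)
      then have "x = g \<otimes> (?n \<otimes> ?a \<otimes> inv ?n) \<otimes> inv g" using a(2) by simp
      also have "\<dots> = (g \<otimes> ?n) \<otimes> ?a \<otimes> inv (g \<otimes> ?n)"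
        using g nc ac by (simp only: inv_mult_group[OF g nc] m_assoc m_closed inv_closed)
      finally show "x \<in> cj (m \<otimes> g)" using aA unfolding cj_def mg by blast
    qed
  qed
  have finC: "finite ?C"
  proof (rule finite_subset)
    show "?C \<subseteq> (\<lambda>C. cj (SOME g. g \<in> C)) ` (rcosets M)"
    proof
      fix B assume "B \<in> ?C"
      then obtain g where g: "g \<in> carrier G" "B = cj g" by blast
      let ?h = "SOME h. h \<in> M #> g"
      have "?h \<in> M #> g" using rcos_self[OF g(1) sM] by (rule someI)
      then obtain m where "m \<in> M" "?h = m \<otimes> g" by (auto simp: r_coset_def)
      then have "cj ?h = B" using cj_M g by simp
      moreover have "M #> g \<in> rcosets M" using g by (auto simp: RCOSETS_def)
      ultimately show "B \<in> (\<lambda>C. cj (SOME g. g \<in> C)) ` (rcosets M)" by blast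
    qed
  qed (use finite_rcosets[OF sM M(2)] in simp)
  \<comment> \<open>\<open>P\<close> collects the families of conjugates with non-trivial
    intersection. A family \<open>J\<close> maximal in \<open>P\<close> plays the role of a minimal
    non-trivial intersection, and \<open>d\<close> below is a non-trivial element of it.\<close>
  define P where "P = {J. J \<subseteq> ?C \<and> J \<noteq> {} \<and> (\<exists>d\<in>\<Inter>J. d \<noteq> \<one>)}"
  have finP: "finite P" by (rule finite_subset[of _ "Pow ?C"]) (use finC P_def in auto)
  have AP: "{A} \<in> P"
  proof -
    have "cj \<one> = A" unfolding cj_def using Ac by (force simp: subset_iff image_iff)
    then have "A \<in> ?C" by blast
    moreover have "\<exists>d\<in>A. d \<noteq> \<one>" using nontriv subgroup.one_closed[OF A(1)] by blast
    ultimately show ?thesis unfolding P_def by simp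
  qed
  obtain J where JP: "J \<in> P" and max: "\<forall>J'\<in>P. J \<subseteq> J' \<longrightarrow> J = J'"
    using finite_has_maximal2[OF finP AP] by blast
  have J: "J \<subseteq> ?C" "J \<noteq> {}" "\<exists>d\<in>\<Inter>J. d \<noteq> \<one>" using JP unfolding P_def by simp_all
  then obtain d where d: "d \<in> \<Inter>J" "d \<noteq> \<one>" by blast
  obtain B0 where B0: "B0 \<in> J" using J(2) by blast
  have dM: "d \<in> M" using d(1) B0 J(1) cj_sub by blast
  have dc: "d \<in> carrier G" using dM Mc by blast
  have sub_cj: "subgroup (cj g) G" if g: "g \<in> carrier G" for g
  proof (rule subgroupI)
    show "cj g \<subseteq> carrier G" using cj_sub[OF g] Mc by blast
    show "cj g \<noteq> {}" unfolding cj_def using subgroup.one_closed[OF A(1)] by blast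
    fix x assume x: "x \<in> cj g"
    then obtain a where a: "a \<in> A" "x = g \<otimes> a \<otimes> inv g" unfolding cj_def by blast
    have "inv x = g \<otimes> inv a \<otimes> inv g" using a g Ac by (simp add: conj_inv subset_iff)
    then show "inv x \<in> cj g" using subgroup.m_inv_closed[OF A(1) a(1)] unfolding cj_def by blast
    fix y assume "y \<in> cj g"
    then obtain b where b: "b \<in> A" "y = g \<otimes> b \<otimes> inv g" unfolding cj_def by blast
    have "x \<otimes> y = g \<otimes> (a \<otimes> b) \<otimes> inv g" using a b g Ac by (simp add: conj_mult[OF g] subset_iff)
    then show "x \<otimes> y \<in> cj g" using subgroup.m_closed[OF A(1) a(1) b(1)] unfolding cj_def by blast
  qed
  have comm_cj: "x \<otimes> y = y \<otimes> x" if g: "g \<in> carrier G" and xy: "x \<in> cj g" "y \<in> cj g" for g x y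
  proof -
    obtain a b where a: "a \<in> A" "x = g \<otimes> a \<otimes> inv g" and b: "b \<in> A" "y = g \<otimes> b \<otimes> inv g"
      using xy unfolding cj_def by blast
    have "a \<in> carrier G" "b \<in> carrier G" using a b Ac by auto
    then have "x \<otimes> y = g \<otimes> (a \<otimes> b) \<otimes> inv g" "y \<otimes> x = g \<otimes> (b \<otimes> a) \<otimes> inv g"
      using a(2) b(2) conj_mult[OF g] by auto
    then show ?thesis using comm[OF a(1) b(1)] by simp
  qed
  \<comment> \<open>If the conjugate belongs to \<open>J\<close>, it is abelian and contains
    \<open>d\<close>. Otherwise the commutator of \<open>d\<close> and \<open>b\<close> lies in it
    and in all members of \<open>J\<close>, since \<open>M\<close> normalizes them all, and
    maximality of \<open>J\<close> makes the commutator trivial.\<close>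
  have commd: "d \<otimes> b = b \<otimes> d" if g: "g \<in> carrier G" and b: "b \<in> cj g" for g b
  proof (cases "cj g \<in> J")
    case True
    then show ?thesis using comm_cj[OF g _ b] d(1) by blast
  next
    case False
    have bM: "b \<in> M" using cj_sub[OF g] b by blast
    have bc: "b \<in> carrier G" using bM Mc by blast
    let ?c = "d \<otimes> b \<otimes> inv d \<otimes> inv b"
    have "?c \<in> cj g"
    proof -
      have "d \<otimes> b \<otimes> inv d \<in> cj (d \<otimes> g)" by (rule cj_conj[OF g dc b])
      then have "d \<otimes> b \<otimes> inv d \<in> cj g" using cj_M[OF dM g] by simp
      then show ?thesis
        by (rule subgroup.m_closed[OF sub_cj[OF g] _ subgroup.m_inv_closed[OF sub_cj[OF g] b]])
    qed
    moreover have "?c \<in> E" if E: "E \<in> J" for E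
    proof -
      obtain h where h: "h \<in> carrier G" "E = cj h" using E J(1) by blast
      have dE: "d \<in> cj h" using d(1) E h(2) by blast
      have "b \<otimes> inv d \<otimes> inv b \<in> cj (b \<otimes> h)"
        by (rule cj_conj[OF h(1) bc subgroup.m_inv_closed[OF sub_cj[OF h(1)] dE]])
      then have "b \<otimes> inv d \<otimes> inv b \<in> cj h" using cj_M[OF bM h(1)] by simp
      then have "d \<otimes> (b \<otimes> inv d \<otimes> inv b) \<in> cj h" by (rule subgroup.m_closed[OF sub_cj[OF h(1)] dE])
      then show ?thesis using dc bc h(2) by (simp add: m_assoc)
    qed
    ultimately have "?c \<in> \<Inter>(insert (cj g) J)" by blast
    moreover have "insert (cj g) J \<notin> P" using max False by blast
    then have "x = \<one>" if "x \<in> \<Inter>(insert (cj g) J)" for x using that g J(1) unfolding P_def by blast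
    ultimately have "?c = \<one>" by blast
    then show ?thesis using commutator_eq_one_iff[OF dc bc] by simp
  qed
  let ?U = "\<Union>?C"
  let ?Z1 = "centralizer G ?U"
  \<comment> \<open>The centre of the centralizer of \<open>?U\<close>. It contains the centre of
    the subgroup generated by \<open>?U\<close> and is closed by construction, so no closure has to
    be formed.\<close>
  let ?Z = "?Z1 \<inter> centralizer G ?Z1"
  have Uc: "?U \<subseteq> carrier G" using cj_sub Mc by blast
  have Z1: "?Z1 \<lhd> G"
  proof (rule normal_centralizer[OF Uc])
    fix g s assume g: "g \<in> carrier G" and "s \<in> ?U"
    then obtain h where h: "h \<in> carrier G" "s \<in> cj h" by blast
    then show "g \<otimes> s \<otimes> inv g \<in> ?U" using cj_conj[OF h(1) g h(2)] g by blast
  qed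
  have Z1c: "?Z1 \<subseteq> carrier G" by (auto simp: centralizer_def)
  have Z2: "centralizer G ?Z1 \<lhd> G"
    by (rule normal_centralizer[OF Z1c normal_conj[OF Z1]])
  have "?Z = {\<one>}"
  proof (rule fitting_freeD[OF ff])
    show "?Z \<lhd> G" by (rule normal_subgroup_intersect[OF Z1 Z2])
    show "closedin T ?Z" by (intro closedin_Int closedin_centralizer Uc Z1c)
    fix x y assume "x \<in> ?Z" "y \<in> ?Z"
    then have "x \<in> centralizer G ?Z1" "y \<in> ?Z1" by blast+
    then show "x \<otimes> y = y \<otimes> x" unfolding centralizer_def[of G ?Z1] by blast
  qed
  moreover have "d \<in> ?Z1" unfolding centralizer_def using commd dc by blast
  moreover have "d \<in> centralizer G ?Z1"
  proof -
    have "d \<in> ?U" using d(1) B0 J(1) by blast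
    then have "z \<otimes> d = d \<otimes> z" if "z \<in> ?Z1" for z using that unfolding centralizer_def[of G ?U] by blast
    then show ?thesis using dc unfolding centralizer_def[of G ?Z1] by simp
  qed
  ultimately show False using d(2) by blast
qed

end

section \<open>Uniformity in JNN\<open>\<^sub>c\<close>F groups\<close>

context profinite_group
begin

text \<open>The form used from here on, with subgroups of \<open>G\<close> in place of factor
  groups.\<close>

lemma JNNF_iff:
  "JNNF c G T \<longleftrightarrow>
     (\<nexists>U. open_subgroup G T U \<and> lower_central G T (c + 1) U = {\<one>}) \<and>
     (\<forall>N. N \<lhd> G \<and> closedin T N \<and> N \<noteq> {\<one>} \<longrightarrow>
        (\<exists>U. open_subgroup G T U \<and> lower_central G T (c + 1) U \<subseteq> N))"
  unfolding JNNF_def virtually_nilpotent_of_class_def[of c G T]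
  using virtually_nilpotent_quotient_iff by auto

lemma one_in_lower_central:
  assumes "subgroup K G" "closedin T K"
  shows "\<one> \<in> lower_central G T i K"
  using subgroup.one_closed[OF lower_central_subgroup[OF assms]] .

lemma JNNF_open_normal:
  assumes "JNNF c G T" "N \<lhd> G" "closedin T N" "N \<noteq> {\<one>}"
  obtains U where "U \<lhd> G" "openin T U" "lower_central G T (c + 1) U \<subseteq> N"
proof -
  obtain V where V: "subgroup V G" "openin T V" "lower_central G T (c + 1) V \<subseteq> N"
    using assms unfolding JNNF_iff open_subgroup_def by blast
  obtain U where U: "U \<lhd> G" "openin T U" "U \<subseteq> V"
    using open_normal_in_nbhd[OF V(2) subgroup.one_closed[OF V(1)]] .
  show ?thesis using that[OF U(1,2)] lower_central_mono[OF U(3), of "c + 1"] V(3) by blast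
qed

lemma normal_open_closed: "U \<lhd> G \<Longrightarrow> openin T U \<Longrightarrow> closedin T U"
  using open_subgroup_closed normal_imp_subgroup by blast

lemma finite_meets_open_trivially:
  assumes "finite F" "F \<subseteq> carrier G"
  obtains N where "N \<lhd> G" "openin T N" "N \<inter> F \<subseteq> {\<one>}"
proof -
  have "closedin T (F - {\<one>})" using assms by (intro closedin_finite) auto
  then have "openin T (carrier G - (F - {\<one>}))" by (simp add: closedin_def topspace_eq)
  then obtain N where "N \<lhd> G" "openin T N" "N \<subseteq> carrier G - (F - {\<one>})"
    using open_normal_in_nbhd by blast
  then show ?thesis using that by blast
qed

text \<open>Distinct elements of \<open>Y\<close> lie in distinct cosets of \<open>B\<close>, and
  these are finitely many.\<close>

lemma finite_if_meets_open_trivially: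
  assumes sY: "subgroup Y G" and B: "subgroup B G" "openin T B" and int: "Y \<inter> B \<subseteq> {\<one>}"
  shows "finite Y"
proof -
  have "inj_on (\<lambda>y. B #> y) Y"
  proof (rule inj_onI)
    fix y z assume yz: "y \<in> Y" "z \<in> Y" "B #> y = B #> z"
    have c: "y \<in> carrier G" "z \<in> carrier G" using yz subgroup.mem_carrier[OF sY] by auto
    have "y \<in> B #> z" using rcos_self[OF c(1) B(1)] yz(3) by simp
    then obtain b where b: "b \<in> B" "y = b \<otimes> z" by (auto simp: r_coset_def)
    have bc: "b \<in> carrier G" using b subgroup.mem_carrier[OF B(1)] by blast
    have "y \<otimes> inv z = b" using b(2) bc c by (simp add: m_assoc)
    moreover have "y \<otimes> inv z \<in> Y"
      by (rule subgroup.m_closed[OF sY yz(1) subgroup.m_inv_closed[OF sY yz(2)]])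
    ultimately have "b \<in> {\<one>}" using b(1) int by blast
    then show "y = z" using b c by simp
  qed
  moreover have "(\<lambda>y. B #> y) ` Y \<subseteq> rcosets B"
    using subgroup.subset[OF sY] by (auto simp: RCOSETS_def)
  ultimately show ?thesis using finite_rcosets[OF B] by (rule inj_on_finite)
qed

text \<open>Otherwise some open \<open>U\<close> has its series term inside \<open>F\<close>;
  cutting \<open>U\<close> down by an open \<open>N\<close> that misses the non-trivial elements of
  \<open>F\<close> makes the term trivial, so \<open>G\<close> itself would be virtually
  nilpotent.\<close>

lemma JNNF_no_finite_normal:
  assumes J: "JNNF c G T" and F: "F \<lhd> G" "finite F"
  shows "F = {\<one>}"
proof (rule ccontr)
  assume ne: "F \<noteq> {\<one>}"
  have Fc: "F \<subseteq> carrier G" using F(1) normal_imp_subgroup subgroup.subset by blast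
  obtain U where U: "U \<lhd> G" "openin T U" "lower_central G T (c + 1) U \<subseteq> F"
    using JNNF_open_normal[OF J F(1) closedin_finite[OF F(2) Fc] ne] .
  obtain N where N: "N \<lhd> G" "openin T N" "N \<inter> F \<subseteq> {\<one>}"
    using finite_meets_open_trivially[OF F(2) Fc] .
  let ?V = "U \<inter> N"
  have V: "?V \<lhd> G" "openin T ?V" using normal_subgroup_intersect[OF U(1) N(1)] U(2) N(2) by auto
  have sV: "subgroup ?V G" "closedin T ?V"
    using V normal_imp_subgroup normal_open_closed by auto
  have "lower_central G T (c + 1) ?V \<subseteq> F"
    using lower_central_mono[of ?V U "c + 1"] U(3) by blast
  moreover have "lower_central G T (c + 1) ?V \<subseteq> ?V" by (rule lower_central_subset[OF sV])
  ultimately have "lower_central G T (c + 1) ?V = {\<one>}"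
    using N(3) one_in_lower_central[OF sV, of "c + 1"] by blast
  moreover have "open_subgroup G T ?V" using sV(1) V(2) unfolding open_subgroup_def by blast
  ultimately show False using J unfolding JNNF_iff by blast
qed

text \<open>The intersection \<open>W\<close> of the maximal proper closed normal subgroups \<open>Y\<close> of \<open>G\<close> inside \<open>Q\<close>
  has the non-generator property. If it were trivial, a minimal supplement to a maximal \<open>Y\<close> in \<open>Q\<close>
  would be a complement, hence a finite normal subgroup.\<close>

lemma nongenerator_subgroup_exists:
  assumes fin: "\<And>F. F \<lhd> G \<Longrightarrow> finite F \<Longrightarrow> F = {\<one>}"
    and Q: "Q \<lhd> G" "closedin T Q" "Q \<noteq> {\<one>}"
  obtains W where "W \<lhd> G" "closedin T W" "W \<noteq> {\<one>}"
    "\<And>R. R \<lhd> G \<Longrightarrow> closedin T R \<Longrightarrow> Q \<subseteq> R <#> W \<Longrightarrow> Q \<subseteq> R"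
proof -
  define P where "P = {Y. Y \<lhd> G \<and> closedin T Y \<and> Y \<subset> Q}"
  define M where "M = {Y \<in> P. \<forall>Z\<in>P. Y \<subseteq> Z \<longrightarrow> Z = Y}"
  have sQ: "subgroup Q G" using Q(1) by (rule normal_imp_subgroup)
  have Qc: "Q \<subseteq> carrier G" by (rule subgroup.subset[OF sQ])
  have PD: "Y \<lhd> G" "closedin T Y" "Y \<subseteq> Q" "Y \<noteq> Q" "subgroup Y G" if "Y \<in> P" for Y
    using that normal_imp_subgroup unfolding P_def by auto
  \<comment> \<open>Choose \<open>q\<close> in \<open>Q\<close> outside \<open>Y\<close> and an open
    normal \<open>B\<close> with \<open>q\<close> outside \<open>Y <#> B\<close>. Only finitely many
    members of \<open>P\<close> contain \<open>Q \<inter> (Y <#> B)\<close>, so a maximal one exists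
    above \<open>Y\<close>; it also contains \<open>Q \<inter> B\<close>, so it is relatively open
    in \<open>Q\<close>.\<close>
  have max: "\<exists>Z\<in>M. Y \<subseteq> Z \<and> (\<exists>B. B \<lhd> G \<and> openin T B \<and> Q \<inter> B \<subseteq> Z)" if Y: "Y \<in> P" for Y
  proof -
    note Y = PD[OF Y]
    obtain q where q: "q \<in> Q" "q \<notin> Y" using Y(3,4) by blast
    obtain B where B: "B \<lhd> G" "openin T B" "q \<notin> Y <#> B"
      using open_normal_separating[OF Y(2) _ q(2)] q(1) Qc by blast
    have sB: "subgroup B G" using B(1) by (rule normal_imp_subgroup)
    have cB: "closedin T B" using B normal_open_closed by blast
    let ?Y = "Q \<inter> (Y <#> B)"
    have YB: "Y \<subseteq> Y <#> B" "B \<subseteq> Y <#> B"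
      using subset_set_mult_left[OF sB subgroup.subset[OF Y(5)]]
        subset_set_mult_right[OF Y(5) subgroup.subset[OF sB]] by auto
    let ?F = "{Z \<in> P. ?Y \<subseteq> Z}"
    have "finite ?F"
    proof (rule finite_subset)
      \<comment> \<open>By the modular law a member \<open>Z\<close> is recovered as
        \<open>Q \<inter> (Z <#> B)\<close>, because \<open>Q \<inter> B\<close> lies in
        \<open>Z\<close>.\<close>
      show "?F \<subseteq> (\<lambda>M. Q \<inter> M) ` {M. subgroup M G \<and> B \<subseteq> M}"
      proof
        fix Z assume Z: "Z \<in> ?F"
        then have ZP: "Z \<in> P" by blast
        note ZD = PD[OF ZP]
        have "subgroup (Z <#> B) G" using normal_set_mult[OF ZD(1) B(1)] by (rule normal_imp_subgroup)
        moreover have "B \<subseteq> Z <#> B"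
          by (rule subset_set_mult_right[OF ZD(5) subgroup.subset[OF sB]])
        moreover have "Z = Q \<inter> (Z <#> B)"
        proof
          show "Z \<subseteq> Q \<inter> (Z <#> B)"
            using subset_set_mult_left[OF sB subgroup.subset[OF ZD(5)]] ZD(3) by blast
          show "Q \<inter> (Z <#> B) \<subseteq> Z"
          proof
            fix x assume x: "x \<in> Q \<inter> (Z <#> B)"
            then have "x \<in> Z <#> B" by blast
            then obtain z b where zb: "z \<in> Z" "b \<in> B" "x = z \<otimes> b" unfolding in_set_mult_iff by blast
            have c: "z \<in> carrier G" "b \<in> carrier G"
              using zb subgroup.mem_carrier[OF ZD(5)] subgroup.mem_carrier[OF sB] by auto
            have "inv z \<otimes> (z \<otimes> b) = b" using c by (simp flip: m_assoc)
            moreover have "inv z \<otimes> x \<in> Q"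
              using x zb(1) ZD(3) by (intro subgroup.m_closed[OF sQ] subgroup.m_inv_closed[OF sQ]) auto
            ultimately have "b \<in> Q" using zb(3) by simp
            then have "b \<in> Z" using zb(2) YB(2) Z by blast
            then show "x \<in> Z" using zb subgroup.m_closed[OF ZD(5)] by blast
          qed
        qed
        ultimately show "Z \<in> (\<lambda>M. Q \<inter> M) ` {M. subgroup M G \<and> B \<subseteq> M}" by blast
      qed
      show "finite ((\<lambda>M. Q \<inter> M) ` {M. subgroup M G \<and> B \<subseteq> M})"
        using finite_subgroups_above[OF sB B(2)] by simp
    qed
    moreover have "?Y \<in> ?F"
    proof -
      have "?Y \<lhd> G" by (intro normal_subgroup_intersect Q(1) normal_set_mult Y(1) B(1))
      moreover have "closedin T ?Y" by (intro closedin_Int Q(2) closedin_set_mult Y(2) cB)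
      ultimately show ?thesis using q(1) B(3) unfolding P_def by blast
    qed
    ultimately obtain Z where Z: "Z \<in> ?F" "\<forall>Z'\<in>?F. Z \<subseteq> Z' \<longrightarrow> Z = Z'"
      using finite_has_maximal[of ?F] by blast
    have "Z \<in> M" unfolding M_def using Z by blast
    moreover have "Y \<subseteq> Z" "Q \<inter> B \<subseteq> Z" using Z(1) YB Y(3) by blast+
    ultimately show ?thesis using B by blast
  qed
  have one: "{\<one>} \<in> P"
    unfolding P_def using one_is_normal closedin_one Q(3) subgroup.one_closed[OF sQ] by blast
  then obtain Y1 B where Y1: "Y1 \<in> M" and B: "B \<lhd> G" "openin T B" "Q \<inter> B \<subseteq> Y1" using max by blast
  have MP: "Y \<in> P" if "Y \<in> M" for Y using that unfolding M_def by blast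
  note Y1D = PD[OF MP[OF Y1]]
  let ?W = "\<Inter>M"
  have W: "?W \<lhd> G" "closedin T ?W"
    using normal_Inter[of M] closedin_Inter[of M T] Y1 PD(1,2)[OF MP] by blast+
  \<comment> \<open>If \<open>Q\<close> is not inside \<open>R\<close>, then
    \<open>Q \<inter> R\<close> lies in a maximal \<open>Y\<close>. As \<open>?W\<close> lies in
    \<open>Y\<close> too, the modular law puts all of \<open>Q\<close> into
    \<open>Y\<close>.\<close>
  have nongen: "Q \<subseteq> R" if R: "R \<lhd> G" "closedin T R" "Q \<subseteq> R <#> ?W" for R
  proof (rule ccontr)
    assume n: "\<not> Q \<subseteq> R"
    have sR: "subgroup R G" using R(1) by (rule normal_imp_subgroup)
    have "Q \<inter> R \<in> P" unfolding P_def using normal_subgroup_intersect[OF Q(1) R(1)] Q(2) R(2) n by blast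
    then obtain Y where Y: "Y \<in> M" "Q \<inter> R \<subseteq> Y" using max by blast
    note YD = PD[OF MP[OF Y(1)]]
    have "Q \<subseteq> Y"
    proof
      fix q assume q: "q \<in> Q"
      then obtain r w where rw: "r \<in> R" "w \<in> ?W" "q = r \<otimes> w" by (rule set_mult_supersetE[OF R(3)])
      have wY: "w \<in> Y" using rw(2) Y(1) by blast
      have c: "r \<in> carrier G" "w \<in> carrier G"
        using rw(1) wY subgroup.mem_carrier[OF sR] subgroup.mem_carrier[OF YD(5)] by auto
      have "q \<otimes> inv w \<in> Q" using q wY YD(3) by (intro subgroup.m_closed[OF sQ] subgroup.m_inv_closed[OF sQ]) auto
      moreover have "q \<otimes> inv w = r" using rw(3) c by (simp add: m_assoc)
      ultimately have "r \<in> Y" using rw(1) Y(2) by blast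
      then show "q \<in> Y" using rw(3) wY subgroup.m_closed[OF YD(5)] by blast
    qed
    then show False using YD(3,4) by blast
  qed
  have "?W \<noteq> {\<one>}"
  proof
    assume triv: "?W = {\<one>}"
    \<comment> \<open>The closed normal supplements of \<open>Y1\<close> in \<open>Q\<close>; a
      minimal one will turn out to be a complement.\<close>
    define S where "S = {Y. Y \<lhd> G \<and> closedin T Y \<and> Y \<subseteq> Q \<and> Q \<subseteq> Y <#> Y1}"
    have "Q \<in> S" unfolding S_def using Q subset_set_mult_left[OF Y1D(5) Qc] by blast
    then have "S \<noteq> {}" by blast
    moreover have "\<Inter>\<C> \<in> S" if C: "\<C> \<noteq> {}" "\<C> \<subseteq> S"
      and ch: "\<And>C D. C \<in> \<C> \<Longrightarrow> D \<in> \<C> \<Longrightarrow> C \<subseteq> D \<or> D \<subseteq> C" for \<C>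
    proof -
      have CD: "C \<lhd> G" "closedin T C" "C \<subseteq> Q" "Q \<subseteq> C <#> Y1" if "C \<in> \<C>" for C
        using that C(2) unfolding S_def by auto
      have "\<Inter>\<C> \<lhd> G" by (rule normal_Inter[OF C(1) CD(1)])
      moreover have "closedin T (\<Inter>\<C>)" by (rule closedin_Inter[OF C(1) CD(2)])
      moreover have "\<Inter>\<C> \<subseteq> Q" using C(1) CD(3) by blast
      moreover have "Q \<subseteq> \<Inter>\<C> <#> Y1"
      proof
        fix q assume q: "q \<in> Q"
        then have qc: "q \<in> carrier G" using Qc by blast
        \<comment> \<open>The possible first factors of \<open>q\<close> in a factorization with
          second factor in \<open>Y1\<close> form a closed set meeting each member of the chain, so
          compactness supplies one in the intersection.\<close>
        let ?K = "{y \<in> carrier G. inv y \<otimes> q \<in> Y1}"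
        have K: "closedin T ?K" by (intro closedin_preimage Y1D(2) continuous_group_intros qc)
        have "\<Inter>\<C> \<inter> ?K \<noteq> {}"
        proof (rule directed_Inter_meets[OF C(1) CD(2) _ K])
          show "\<exists>E\<in>\<C>. E \<subseteq> C \<inter> D" if "C \<in> \<C>" "D \<in> \<C>" for C D using that ch[OF that] by blast
          fix C assume C: "C \<in> \<C>"
          then obtain y y1 where y: "y \<in> C" "y1 \<in> Y1" "q = y \<otimes> y1"
            by (rule set_mult_supersetE[OF CD(4) q])
          have c: "y \<in> carrier G" "y1 \<in> carrier G"
            using y CD(3)[OF C] Qc subgroup.mem_carrier[OF Y1D(5)] by auto
          have "inv y \<otimes> (y \<otimes> y1) = y1" using c by (simp flip: m_assoc)
          then have "y \<in> C \<inter> ?K" using y c by simp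
          then show "C \<inter> ?K \<noteq> {}" by blast
        qed
        then obtain y where y: "y \<in> \<Inter>\<C>" "y \<in> carrier G" "inv y \<otimes> q \<in> Y1" by blast
        moreover have "q = y \<otimes> (inv y \<otimes> q)" using y(2) qc by (simp flip: m_assoc)
        ultimately show "q \<in> \<Inter>\<C> <#> Y1" unfolding in_set_mult_iff by blast
      qed
      ultimately show ?thesis unfolding S_def by blast
    qed
    ultimately obtain Y where Y: "Y \<in> S" and min: "\<And>Z. Z \<in> S \<Longrightarrow> Z \<subseteq> Y \<Longrightarrow> Z = Y"
      using minimal_exists[of S] by blast
    have YD: "Y \<lhd> G" "closedin T Y" "Y \<subseteq> Q" "Q \<subseteq> Y <#> Y1" using Y unfolding S_def by auto
    have sY: "subgroup Y G" using YD(1) by (rule normal_imp_subgroup)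
    \<comment> \<open>A non-trivial common element \<open>y\<close> is missed by some maximal
      \<open>Z\<close>, so \<open>Y \<inter> Y1\<close> and \<open>Z\<close> generate
      \<open>Q\<close>. Splitting elements of \<open>Y\<close> accordingly shows that
      \<open>Y \<inter> Z\<close> still supplements \<open>Y1\<close>, against the minimality of
      \<open>Y\<close>.\<close>
    have int: "Y \<inter> Y1 \<subseteq> {\<one>}"
    proof
      fix y assume y: "y \<in> Y \<inter> Y1"
      show "y \<in> {\<one>}"
      proof (rule ccontr)
        assume "y \<notin> {\<one>}"
        then obtain Z where Z: "Z \<in> M" "y \<notin> Z" using triv by blast
        note ZD = PD[OF MP[OF Z(1)]]
        let ?D = "(Y \<inter> Y1) <#> Z"
        have n: "Y \<inter> Y1 \<lhd> G" by (rule normal_subgroup_intersect[OF YD(1) Y1D(1)])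
        have sn: "subgroup (Y \<inter> Y1) G" using n by (rule normal_imp_subgroup)
        have "?D \<lhd> G" by (rule normal_set_mult[OF n ZD(1)])
        moreover have "closedin T ?D" using YD(2) Y1D(2) ZD(2) by (intro closedin_set_mult) auto
        moreover have DQ: "?D \<subseteq> Q" using YD(3) ZD(3) by (intro set_mult_subset_subgroup[OF sQ]) auto
        moreover have "Z \<subseteq> ?D" by (rule subset_set_mult_right[OF sn subgroup.subset[OF ZD(5)]])
        moreover have "y \<in> ?D" using subset_set_mult_left[OF ZD(5) subgroup.subset[OF sn]] y by blast
        ultimately have D: "?D = Q" using Z unfolding M_def P_def by blast
        have "Y \<inter> Z \<in> S"
        proof -
          have "Q \<subseteq> (Y \<inter> Z) <#> Y1"
          proof
            fix q assume "q \<in> Q"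
            then obtain a x1 where a: "a \<in> Y" "x1 \<in> Y1" "q = a \<otimes> x1"
              by (rule set_mult_supersetE[OF YD(4)])
            then have "a \<in> ?D" using D YD(3) by blast
            then obtain b x where b: "b \<in> Y" "b \<in> Y1" "x \<in> Z" "a = b \<otimes> x"
              unfolding in_set_mult_iff by blast
            have c: "b \<in> carrier G" "x \<in> carrier G" "x1 \<in> carrier G"
              using a(2) b subgroup.mem_carrier[OF sY] subgroup.mem_carrier[OF ZD(5)]
                subgroup.mem_carrier[OF Y1D(5)] by auto
            have "inv b \<otimes> a \<in> Y"
              by (rule subgroup.m_closed[OF sY subgroup.m_inv_closed[OF sY b(1)] a(1)])
            moreover have "inv b \<otimes> (b \<otimes> x) = x" using c by (simp flip: m_assoc)
            ultimately have "x \<in> Y \<inter> Z" using b by simp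
            moreover have "inv x \<otimes> b \<otimes> x \<otimes> x1 \<in> Y1"
              by (rule subgroup.m_closed[OF Y1D(5) normal.inv_op_closed1[OF Y1D(1) c(2) b(2)] a(2)])
            moreover have "q = x \<otimes> (inv x \<otimes> b \<otimes> x \<otimes> x1)"
            proof -
              have "x \<otimes> (inv x \<otimes> (b \<otimes> (x \<otimes> x1))) = b \<otimes> (x \<otimes> x1)" using c by (simp flip: m_assoc)
              then show ?thesis using a(3) b(4) c by (simp add: m_assoc)
            qed
            ultimately show "q \<in> (Y \<inter> Z) <#> Y1" unfolding in_set_mult_iff by blast
          qed
          moreover have "Y \<inter> Z \<lhd> G" by (rule normal_subgroup_intersect[OF YD(1) ZD(1)])
          ultimately show ?thesis unfolding S_def using YD(2,3) ZD(2) by blast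
        qed
        then have "Y \<inter> Z = Y" using min by blast
        then show False using y Z(2) by blast
      qed
    qed
    \<comment> \<open>Relative openness of \<open>Y1\<close> in \<open>Q\<close> enters here: it
      makes the complement \<open>Y\<close> finite, hence trivial, and \<open>Y1\<close> would be
      all of \<open>Q\<close>.\<close>
    have "Y \<inter> B \<subseteq> {\<one>}" using B(3) YD(3) int by blast
    then have "finite Y" by (rule finite_if_meets_open_trivially[OF sY normal_imp_subgroup[OF B(1)] B(2)])
    then have "Y = {\<one>}" using fin YD(1) by blast
    then have "Q \<subseteq> Y1" using YD(4) set_mult_subset_subgroup[OF Y1D(5), of Y Y1] subgroup.one_closed[OF Y1D(5)] by blast
    then show False using Y1D(3,4) by blast
  qed
  then show ?thesis using that W nongen by blast
qed

section \<open>A bound valid for all closed normal subgroups not contained in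
  \<open>K\<close>\<close>

lemma lower_central_normal_product:
  assumes "A \<lhd> G" "closedin T A" "V \<lhd> G" "closedin T V"
  shows "lower_central G T (Suc i) (A <#> V) \<subseteq> A <#> lower_central G T (Suc i) V"
proof (rule lower_central_set_mult_subset)
  show sA: "subgroup A G" and sV: "subgroup V G" using assms normal_imp_subgroup by blast+
  show "closedin T V" by (rule assms)
  show "v \<otimes> a \<otimes> inv v \<in> A" if "v \<in> V" "a \<in> A" for v a
    using normal_conj[OF assms(1)] that subgroup.mem_carrier[OF sV] by blast
  show "closedin T (A <#> lower_central G T j V)" for j
    by (intro closedin_set_mult assms(2) lower_central_closedin[OF sV assms(4)])
qed

lemma JNNF_locally_uniform:
  assumes J: "JNNF c G T" and ff: "fitting_free G T"
    and R: "R \<lhd> G" "closedin T R" "R \<noteq> {\<one>}"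
  obtains U V where "U \<lhd> G" "openin T U" "V \<lhd> G" "openin T V"
    "\<And>R'. R' \<lhd> G \<Longrightarrow> closedin T R' \<Longrightarrow> R \<subseteq> R' <#> V \<Longrightarrow> lower_central G T (c + 1) U \<subseteq> R'"
proof -
  let ?Q = "lower_central G T (c + 1) R"
  have Q: "?Q \<lhd> G" "closedin T ?Q" "?Q \<noteq> {\<one>}"
    using lower_central_normal[OF R(1,2)] lower_central_closedin[OF normal_imp_subgroup[OF R(1)] R(2)]
      lower_central_nontrivial[OF ff R, of c] by simp_all
  obtain W where W: "W \<lhd> G" "closedin T W" "W \<noteq> {\<one>}"
    "\<And>R. R \<lhd> G \<Longrightarrow> closedin T R \<Longrightarrow> ?Q \<subseteq> R <#> W \<Longrightarrow> ?Q \<subseteq> R"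
    using nongenerator_subgroup_exists[OF JNNF_no_finite_normal[OF J] Q] by metis
  obtain V where V: "V \<lhd> G" "openin T V" "lower_central G T (c + 1) V \<subseteq> W"
    using JNNF_open_normal[OF J W(1-3)] .
  obtain U where U: "U \<lhd> G" "openin T U" "lower_central G T (c + 1) U \<subseteq> ?Q"
    using JNNF_open_normal[OF J Q] .
  show ?thesis
  proof (rule that[OF U(1,2) V(1,2)])
    fix R' assume R': "R' \<lhd> G" "closedin T R'" "R \<subseteq> R' <#> V"
    have "?Q \<subseteq> lower_central G T (c + 1) (R' <#> V)" by (rule lower_central_mono[OF R'(3)])
    also have "\<dots> \<subseteq> R' <#> lower_central G T (c + 1) V"
      using lower_central_normal_product[OF R'(1,2) V(1) normal_open_closed[OF V(1,2)], of c] by simp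
    also have "\<dots> \<subseteq> R' <#> W" by (rule mono_set_mult[OF order_refl V(3)])
    finally have "?Q \<subseteq> R'" by (rule W(4)[OF R'(1,2)])
    then show "lower_central G T (c + 1) U \<subseteq> R'" using U(3) by blast
  qed
qed

text \<open>A minimal closed normal \<open>R\<close> that is approximated by counterexamples \<open>R'\<close> is not contained
  in \<open>K\<close>, so the locally uniform bound applies to it; by the finiteness of the set of normal subgroups
  above \<open>V\<close>, a counterexample close enough to \<open>R\<close> satisfies \<open>R \<subseteq> R' <#> V\<close>.\<close>

lemma JNNF_uniform:
  assumes J: "JNNF c G T" and ff: "fitting_free G T" and K: "subgroup K G" "openin T K"
  shows "\<exists>U. U \<lhd> G \<and> openin T U \<and>
    (\<forall>R. R \<lhd> G \<and> closedin T R \<and> \<not> R \<subseteq> K \<longrightarrow> lower_central G T (c + 1) U \<subseteq> R)"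
proof (rule ccontr)
  let ?g = "lower_central G T (c + 1)"
  assume contra: "\<not> ?thesis"
  define bad where "bad U R' \<longleftrightarrow> R' \<lhd> G \<and> closedin T R' \<and> \<not> R' \<subseteq> K \<and> \<not> ?g U \<subseteq> R'" for U R'
  define on where "on U \<longleftrightarrow> U \<lhd> G \<and> openin T U" for U
  have ex_bad: "\<exists>R'. bad U R'" if "on U" for U
    using contra that unfolding bad_def on_def by blast
  \<comment> \<open>\<open>E\<close> consists of the \<open>R\<close> that contain, up to each open
    normal \<open>U\<close>, a counterexample for that same \<open>U\<close>. A minimal such
    \<open>R\<close> is a limit of counterexamples.\<close>
  define E where "E = {R. R \<lhd> G \<and> closedin T R \<and> (\<forall>U. on U \<longrightarrow> (\<exists>R'. bad U R' \<and> R' \<subseteq> R <#> U))}"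
  have ED: "C \<lhd> G" "closedin T C" "\<And>U. on U \<Longrightarrow> \<exists>R'. bad U R' \<and> R' \<subseteq> C <#> U" if "C \<in> E" for C
    using that unfolding E_def by simp_all
  have EI: "C \<in> E" if "C \<lhd> G" "closedin T C" "\<And>U. on U \<Longrightarrow> \<exists>R'. bad U R' \<and> R' \<subseteq> C <#> U" for C
    using that unfolding E_def by simp
  have onD: "subgroup U G" "U \<subseteq> carrier G" "closedin T U" if "on U" for U
    using that normal_imp_subgroup normal_open_closed subgroup.subset unfolding on_def by blast+
  have "carrier G \<in> E"
  proof -
    have "\<exists>R'. bad U R' \<and> R' \<subseteq> carrier G <#> U" if U: "on U" for U
    proof -
      obtain R' where R': "bad U R'" using ex_bad[OF U] by blast
      then have "R' \<lhd> G" unfolding bad_def by blast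
      then have "R' \<subseteq> carrier G" using normal_imp_subgroup subgroup.subset by blast
      also have "\<dots> \<subseteq> carrier G <#> U" by (rule subset_set_mult_left[OF onD(1)[OF U] order_refl])
      finally show ?thesis using R' by blast
    qed
    moreover have "closedin T (carrier G)" using closedin_topspace[of T] by (simp add: topspace_eq)
    ultimately show ?thesis by (intro EI normal_self)
  qed
  then have "E \<noteq> {}" by blast
  moreover have "\<Inter>\<C> \<in> E" if C: "\<C> \<noteq> {}" "\<C> \<subseteq> E"
    and ch: "\<And>C D. C \<in> \<C> \<Longrightarrow> D \<in> \<C> \<Longrightarrow> C \<subseteq> D \<or> D \<subseteq> C" for \<C>
  proof -
    have CE: "C \<in> E" if "C \<in> \<C>" for C using that C(2) by blast
    note CD = ED(1,2)[OF CE]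
    have n: "\<Inter>\<C> \<lhd> G" by (rule normal_Inter[OF C(1) CD(1)])
    have cl: "closedin T (\<Inter>\<C>)" by (rule closedin_Inter[OF C(1) CD(2)])
    have "\<exists>R'. bad U R' \<and> R' \<subseteq> \<Inter>\<C> <#> U" if U: "on U" for U
    proof -
      have c: "\<Inter>\<C> \<subseteq> carrier G" by (rule closed_subset_carrier[OF cl])
      \<comment> \<open>An open subgroup containing the intersection of the chain, so by compactness
        some member \<open>C\<close> already lies in it. A counterexample inside
        \<open>C <#> U\<close> is then inside \<open>?B\<close>.\<close>
      let ?B = "\<Inter>\<C> <#> U"
      have oB: "openin T ?B" using openin_set_mult[OF _ c] U unfolding on_def by blast
      have sB: "subgroup ?B G"
        using normal_set_mult[OF n] normal_imp_subgroup U unfolding on_def by blast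
      have "\<exists>C\<in>\<C>. C \<subseteq> ?B"
      proof (rule directed_Inter_subset_open[OF C(1) CD(2) _ oB])
        show "\<exists>E\<in>\<C>. E \<subseteq> C \<inter> D" if "C \<in> \<C>" "D \<in> \<C>" for C D using that ch[OF that] by blast
        show "\<Inter>\<C> \<subseteq> ?B" by (rule subset_set_mult_left[OF onD(1)[OF U] c])
      qed
      then obtain C where C': "C \<in> \<C>" "C \<subseteq> ?B" by blast
      then obtain R' where R': "bad U R'" "R' \<subseteq> C <#> U" using ED(3)[OF CE[OF C'(1)] U] by blast
      have "U \<subseteq> ?B" by (rule subset_set_mult_right[OF normal_imp_subgroup[OF n] onD(2)[OF U]])
      then have "C <#> U \<subseteq> ?B" by (rule set_mult_subset_subgroup[OF sB C'(2)])
      then show ?thesis using R' by blast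
    qed
    then show ?thesis by (rule EI[OF n cl])
  qed
  ultimately obtain R where R: "R \<in> E" and min: "\<And>Z. Z \<in> E \<Longrightarrow> Z \<subseteq> R \<Longrightarrow> Z = R"
    using minimal_exists[of E] by blast
  note RD = ED(1,2)[OF R] and Rbad = ED(3)[OF R]
  have sR: "subgroup R G" using RD(1) by (rule normal_imp_subgroup)
  \<comment> \<open>With \<open>U\<close> chosen inside \<open>K\<close>, a counterexample in
    \<open>R <#> U\<close> would lie in \<open>K\<close>, which counterexamples never do.\<close>
  have "\<not> R \<subseteq> K"
  proof
    assume RK: "R \<subseteq> K"
    obtain U where U: "U \<lhd> G" "openin T U" "U \<subseteq> K"
      using open_normal_in_nbhd[OF K(2) subgroup.one_closed[OF K(1)]] .
    then obtain R' where R': "bad U R'" "R' \<subseteq> R <#> U" using Rbad unfolding on_def by blast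
    moreover have "R <#> U \<subseteq> K" by (rule set_mult_subset_subgroup[OF K(1) RK U(3)])
    ultimately show False unfolding bad_def by blast
  qed
  then have "R \<noteq> {\<one>}" using subgroup.one_closed[OF K(1)] by blast
  then obtain U1 V where UV: "on U1" "on V"
    "\<And>R'. R' \<lhd> G \<Longrightarrow> closedin T R' \<Longrightarrow> R \<subseteq> R' <#> V \<Longrightarrow> ?g U1 \<subseteq> R'"
    using JNNF_locally_uniform[OF J ff RD] unfolding on_def by metis
  define \<N> where "\<N> = {Z. Z \<lhd> G \<and> V \<subseteq> Z \<and> \<not> R \<subseteq> Z}"
  have "finite \<N>"
  proof (rule finite_subset)
    show "\<N> \<subseteq> {M. subgroup M G \<and> V \<subseteq> M}" unfolding \<N>_def using normal_imp_subgroup by blast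
    show "finite {M. subgroup M G \<and> V \<subseteq> M}"
      using finite_subgroups_above onD(1)[OF UV(2)] UV(2) unfolding on_def by blast
  qed
  \<comment> \<open>For \<open>Z\<close> in \<open>\<N>\<close> the intersection
    \<open>R \<inter> Z\<close> is strictly smaller than \<open>R\<close>, so minimality excludes it
    from \<open>E\<close>; \<open>u\<close> witnesses this.\<close>
  have "\<exists>u. on u \<and> (\<forall>R'. bad u R' \<longrightarrow> \<not> R' \<subseteq> (R \<inter> Z) <#> u)" if Z: "Z \<in> \<N>" for Z
  proof -
    have ZD: "Z \<lhd> G" "V \<subseteq> Z" "\<not> R \<subseteq> Z" using Z unfolding \<N>_def by auto
    have "openin T Z"
      using openin_subgroup_mono[OF normal_imp_subgroup[OF ZD(1)] onD(1)[OF UV(2)] _ ZD(2)] UV(2)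
      unfolding on_def by blast
    then have "closedin T (R \<inter> Z)" using RD(2) normal_open_closed[OF ZD(1)] by blast
    moreover have "R \<inter> Z \<lhd> G" by (rule normal_subgroup_intersect[OF RD(1) ZD(1)])
    moreover have "R \<inter> Z \<notin> E" using min[of "R \<inter> Z"] ZD(3) by blast
    ultimately show ?thesis using EI by blast
  qed
  then obtain u where u: "\<And>Z. Z \<in> \<N> \<Longrightarrow> on (u Z)"
    "\<And>Z R'. Z \<in> \<N> \<Longrightarrow> bad (u Z) R' \<Longrightarrow> \<not> R' \<subseteq> (R \<inter> Z) <#> u Z" by metis
  let ?S = "insert U1 (insert V (u ` \<N>))"
  let ?U = "\<Inter>?S"
  have S: "on W" if "W \<in> ?S" for W using that u(1) UV(1,2) by blast
  have "on ?U"
  proof -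
    have "?U \<lhd> G" by (rule normal_Inter) (use S on_def in auto)
    moreover have "openin T ?U"
      by (rule openin_Inter) (use \<open>finite \<N>\<close> S on_def in auto)
    ultimately show ?thesis unfolding on_def by blast
  qed
  then obtain R' where R': "bad ?U R'" "R' \<subseteq> R <#> ?U" using Rbad by blast
  have R'D: "R' \<lhd> G" "closedin T R'" "\<not> R' \<subseteq> K" "\<not> ?g ?U \<subseteq> R'" using R'(1) unfolding bad_def by auto
  have mono: "?g ?U \<subseteq> ?g W" if "W \<in> ?S" for W
    by (rule lower_central_mono) (use that in blast)
  \<comment> \<open>\<open>R'\<close> is a counterexample for \<open>?U\<close>, hence for
    \<open>U1\<close> and every \<open>u Z\<close>. The bound for \<open>U1\<close> shows that
    \<open>R\<close> is not inside \<open>?Z\<close>, so \<open>?Z\<close> is in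
    \<open>\<N>\<close>; yet intersecting \<open>R <#> ?U\<close> with \<open>?Z\<close> puts
    \<open>R'\<close> into \<open>(R \<inter> ?Z) <#> u ?Z\<close>.\<close>
  let ?Z = "R' <#> V"
  have VG: "V \<lhd> G" using UV(2) unfolding on_def by blast
  have nZ: "?Z \<lhd> G" by (rule normal_set_mult[OF R'D(1) VG])
  have sZ: "subgroup ?Z G" using nZ by (rule normal_imp_subgroup)
  have sR': "subgroup R' G" using R'D(1) by (rule normal_imp_subgroup)
  have VZ: "V \<subseteq> ?Z" by (rule subset_set_mult_right[OF sR' onD(2)[OF UV(2)]])
  have RZ: "R' \<subseteq> ?Z" by (rule subset_set_mult_left[OF onD(1)[OF UV(2)] subgroup.subset[OF sR']])
  have "\<not> R \<subseteq> ?Z" using UV(3)[OF R'D(1,2)] mono[of U1] R'D(4) by blast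
  then have Z: "?Z \<in> \<N>" unfolding \<N>_def using nZ VZ by blast
  then have "bad (u ?Z) R'" using R'D mono[of "u ?Z"] unfolding bad_def by blast
  then have "\<not> R' \<subseteq> (R \<inter> ?Z) <#> u ?Z" by (rule u(2)[OF Z])
  moreover have "R' \<subseteq> (R \<inter> ?Z) <#> u ?Z"
  proof
    fix x assume x: "x \<in> R'"
    then obtain r w where rw: "r \<in> R" "w \<in> ?U" "x = r \<otimes> w" by (rule set_mult_supersetE[OF R'(2)])
    have w: "w \<in> V" "w \<in> u ?Z" using rw(2) Z by blast+
    have c: "r \<in> carrier G" "w \<in> carrier G"
      using rw(1) w(1) subgroup.mem_carrier[OF sR] onD(2)[OF UV(2)] by auto
    have "x \<otimes> inv w \<in> ?Z" using x w(1) RZ VZ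
      by (intro subgroup.m_closed[OF sZ] subgroup.m_inv_closed[OF sZ]) auto
    moreover have "x \<otimes> inv w = r" using rw(3) c by (simp add: m_assoc)
    ultimately have "r \<in> R \<inter> ?Z" using rw(1) by simp
    then show "x \<in> (R \<inter> ?Z) <#> u ?Z" using rw(3) w(2) unfolding in_set_mult_iff by blast
  qed
  ultimately show False by blast
qed

end

section \<open>Countability of the set of open subgroups\<close>

context group
begin

lemma mem_normalizer_iff:
  assumes "L \<subseteq> carrier G"
  shows "g \<in> normalizer G L \<longleftrightarrow> g \<in> carrier G \<and> (\<lambda>x. g \<otimes> x \<otimes> inv g) ` L = L"
proof -
  have "g <# L #> inv g = (\<lambda>x. g \<otimes> x \<otimes> inv g) ` L"
    by (auto simp: l_coset_def r_coset_def)
  then show ?thesis using assms by (simp add: normalizer_def stabilizer_def)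
qed

lemma normalizer_conj:
  assumes "L \<subseteq> carrier G" "g \<in> normalizer G L" "x \<in> L"
  shows "g \<otimes> x \<otimes> inv g \<in> L"
  using assms mem_normalizer_iff by blast

text \<open>Inclusion of the conjugates suffices: applied to \<open>inv k\<close>, it gives the
  reverse inclusion for \<open>k\<close>.\<close>

lemma subset_normalizerI:
  assumes L: "L \<subseteq> carrier G" and K: "subgroup K G"
    and conj: "\<And>k x. k \<in> K \<Longrightarrow> x \<in> L \<Longrightarrow> k \<otimes> x \<otimes> inv k \<in> L"
  shows "K \<subseteq> normalizer G L"
proof
  fix k assume k: "k \<in> K"
  have kc: "k \<in> carrier G" using k subgroup.mem_carrier[OF K] by blast
  have ik: "inv k \<in> K" by (rule subgroup.m_inv_closed[OF K k])
  have "L \<subseteq> (\<lambda>x. k \<otimes> x \<otimes> inv k) ` L"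
  proof
    fix x assume x: "x \<in> L"
    then have xc: "x \<in> carrier G" using L by blast
    have "k \<otimes> (inv k \<otimes> x) = x" using kc xc by (simp flip: m_assoc)
    then have "x = k \<otimes> (inv k \<otimes> x \<otimes> k) \<otimes> inv k" using kc xc by (simp add: m_assoc)
    moreover have "inv k \<otimes> x \<otimes> k \<in> L" using conj[OF ik x] kc by simp
    ultimately show "x \<in> (\<lambda>x. k \<otimes> x \<otimes> inv k) ` L" by blast
  qed
  then show "k \<in> normalizer G L"
    using mem_normalizer_iff[OF L] kc conj[OF k] by blast
qed

text \<open>Every element is the value of a finite word over the generators and their
  inverses.\<close>

lemma countable_generate:
  assumes S: "countable S" "S \<subseteq> carrier G"
  shows "countable (generate G S)"
proof -
  let ?S = "S \<union> (\<lambda>x. inv x) ` S"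
  let ?f = "\<lambda>l. foldr (\<lambda>x y. x \<otimes> y) l \<one>"
  have cl: "?f l \<in> carrier G" if "l \<in> lists ?S" for l
    using that S(2) by (induction l) auto
  have app: "?f (l @ l') = ?f l \<otimes> ?f l'" if "l \<in> lists ?S" "l' \<in> lists ?S" for l l'
    using that(1)
  proof (induction l)
    case (Cons a l)
    have "a \<in> carrier G" using Cons.hyps(1) S(2) by auto
    then show ?case using Cons.IH cl[OF Cons.hyps(2)] cl[OF that(2)] by (simp add: m_assoc)
  qed (use cl[OF that(2)] in simp)
  have "generate G S \<subseteq> ?f ` lists ?S"
  proof
    fix x assume "x \<in> generate G S"
    then show "x \<in> ?f ` lists ?S"
    proof induction
      case one
      show ?case by (rule image_eqI[of _ _ "[]"]) auto
    next
      case (incl h)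
      show ?case by (rule image_eqI[of _ _ "[h]"]) (use incl S(2) in auto)
    next
      case (inv h)
      show ?case by (rule image_eqI[of _ _ "[inv h]"]) (use inv S(2) in auto)
    next
      case (eng h1 h2)
      then obtain l1 l2 where l: "l1 \<in> lists ?S" "h1 = ?f l1" "l2 \<in> lists ?S" "h2 = ?f l2" by blast
      show ?case by (rule image_eqI[of _ _ "l1 @ l2"]) (use l app[OF l(1,3)] in auto)
    qed
  qed
  moreover have "countable (?f ` lists ?S)" using S(1) by simp
  ultimately show ?thesis by (rule countable_subset)
qed

text \<open>A subgroup is determined on \<open>generate G S\<close> by the action of the generators on coset
  representatives.\<close>

lemma generate_Int_subset_if_same_coset_table:
  assumes N: "subgroup N G" "subgroup N' G" and S: "S \<subseteq> carrier G"
    and F: "F \<subseteq> carrier G" "\<one> \<in> F" and cover: "\<And>x. x \<in> carrier G \<Longrightarrow> \<exists>f\<in>F. x \<otimes> inv f \<in> N"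
    and table: "\<And>s f f'. s \<in> S \<union> (\<lambda>x. inv x) ` S \<Longrightarrow> f \<in> F \<Longrightarrow> f' \<in> F \<Longrightarrow> f \<otimes> s \<otimes> inv f' \<in> N \<Longrightarrow> f \<otimes> s \<otimes> inv f' \<in> N'"
    and base: "\<And>f. f \<in> F \<Longrightarrow> f \<in> N \<Longrightarrow> f \<in> N'"
  shows "generate G S \<inter> N \<subseteq> N'"
proof
  have gen: "\<exists>f'\<in>F. f \<otimes> s \<otimes> inv f' \<in> N \<and> f \<otimes> s \<otimes> inv f' \<in> N'"
    if s: "s \<in> S \<union> (\<lambda>x. inv x) ` S" and f: "f \<in> F" for s f
  proof -
    have "f \<otimes> s \<in> carrier G" using s f S F(1) by auto
    then obtain f' where "f' \<in> F" "f \<otimes> s \<otimes> inv f' \<in> N" using cover by blast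
    then show ?thesis using table[OF s f] by blast
  qed
  \<comment> \<open>Reading \<open>w\<close> letter by letter moves a representative
    \<open>f\<close> to a representative \<open>f'\<close>; the corrections lie in both subgroups,
    and for a product they multiply.\<close>
  have key: "\<exists>f'\<in>F. f \<otimes> w \<otimes> inv f' \<in> N \<and> f \<otimes> w \<otimes> inv f' \<in> N'" if "w \<in> generate G S" "f \<in> F" for w f
    using that
  proof (induction arbitrary: f)
    case one
    then show ?case using F(1) subgroup.one_closed[OF N(1)] subgroup.one_closed[OF N(2)]
      by (intro bexI[of _ f]) auto
  next
    case (incl h)
    then show ?case using gen[of h f] by blast
  next
    case (inv h)
    then show ?case using gen[of "inv h" f] by blast
  next
    case (eng h1 h2)
    obtain f1 where f1: "f1 \<in> F" "f \<otimes> h1 \<otimes> inv f1 \<in> N" "f \<otimes> h1 \<otimes> inv f1 \<in> N'" using eng by blast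
    obtain f2 where f2: "f2 \<in> F" "f1 \<otimes> h2 \<otimes> inv f2 \<in> N" "f1 \<otimes> h2 \<otimes> inv f2 \<in> N'" using eng f1(1) by blast
    have c: "f \<in> carrier G" "f1 \<in> carrier G" "f2 \<in> carrier G" "h1 \<in> carrier G" "h2 \<in> carrier G"
      using eng.prems f1(1) f2(1) F(1) eng.hyps generate_in_carrier[OF S] by auto
    have "inv f1 \<otimes> (f1 \<otimes> (h2 \<otimes> inv f2)) = h2 \<otimes> inv f2" using c by (simp flip: m_assoc)
    then have "f \<otimes> (h1 \<otimes> h2) \<otimes> inv f2 = (f \<otimes> h1 \<otimes> inv f1) \<otimes> (f1 \<otimes> h2 \<otimes> inv f2)"
      using c by (simp add: m_assoc)
    then show ?case
      using f2(1) subgroup.m_closed[OF N(1) f1(2) f2(2)] subgroup.m_closed[OF N(2) f1(3) f2(3)]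
      by (intro bexI[of _ f2]) simp_all
  qed
  fix w assume w: "w \<in> generate G S \<inter> N"
  \<comment> \<open>Starting at \<open>\<one>\<close>, the end point \<open>f\<close> must lie in
    \<open>N\<close> because \<open>w\<close> does, so \<open>base\<close> moves it to
    \<open>N'\<close>.\<close>
  then obtain f where f: "f \<in> F" "\<one> \<otimes> w \<otimes> inv f \<in> N" "\<one> \<otimes> w \<otimes> inv f \<in> N'"
    using key[of w \<one>] F(2) by blast
  have c: "w \<in> carrier G" "f \<in> carrier G" using w f(1) F(1) subgroup.mem_carrier[OF N(1)] by auto
  have f': "w \<otimes> inv f \<in> N" "w \<otimes> inv f \<in> N'" using f c by auto
  have "inv (w \<otimes> inv f) \<otimes> w \<in> N"
    using w by (intro subgroup.m_closed[OF N(1) subgroup.m_inv_closed[OF N(1) f'(1)]]) auto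
  moreover have "inv (w \<otimes> inv f) \<otimes> w = f" using c by (simp add: inv_mult_group m_assoc)
  ultimately have "f \<in> N'" using base f(1) by simp
  then have "(w \<otimes> inv f) \<otimes> f \<in> N'" by (rule subgroup.m_closed[OF N(2) f'(2)])
  then show "w \<in> N'" using c by (simp add: m_assoc)
qed

end

context profinite_group
begin

lemma dense_meets_open:
  assumes "T closure_of D = carrier G" "openin T U" "x \<in> U"
  shows "\<exists>d\<in>D. d \<in> U"
proof -
  have "x \<in> T closure_of D" using assms open_subset_carrier by blast
  then show ?thesis using assms(2,3) unfolding in_closure_of by blast
qed

text \<open>Each open subgroup is coded by finite data over a countable dense subgroup:
  representatives, coset table, and the representatives inside the subgroup. The code determines the
  trace on the dense subgroup, and this trace determines the open subgroup.\<close>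

lemma countable_open_subgroups:
  assumes "topologically_finitely_generated G T"
  shows "countable {N. subgroup N G \<and> openin T N}"
proof -
  obtain S where S: "finite S" "S \<subseteq> carrier G" and dense: "T closure_of generate G S = carrier G"
    using assms unfolding topologically_finitely_generated_def by blast
  let ?D = "generate G S" and ?S = "S \<union> (\<lambda>x. inv x) ` S" and ?N = "{N. subgroup N G \<and> openin T N}"
  have Dc: "?D \<subseteq> carrier G" by (rule generate_incl[OF S(2)])
  have cD: "countable ?D" by (rule countable_generate[OF countable_finite[OF S(1)] S(2)])
  define reps where "reps N F \<longleftrightarrow>
    finite F \<and> F \<subseteq> ?D \<and> \<one> \<in> F \<and> (\<forall>x\<in>carrier G. \<exists>f\<in>F. x \<otimes> inv f \<in> N)" for N F
  have "\<exists>F. reps N F" if N: "N \<in> ?N" for N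
  proof -
    have sN: "subgroup N G" and oN: "openin T N" using N by auto
    \<comment> \<open>Density lets the representatives be taken in the countable set
      \<open>?D\<close>.\<close>
    have "\<exists>d\<in>?D. d \<in> C" if C: "C \<in> rcosets N" for C
    proof -
      obtain a where a: "a \<in> carrier G" "C = N #> a" using C unfolding RCOSETS_def by blast
      show ?thesis
        unfolding a(2) by (rule dense_meets_open[OF dense openin_rcoset[OF sN oN a(1)] rcos_self[OF a(1) sN]])
    qed
    then obtain r where r: "\<And>C. C \<in> rcosets N \<Longrightarrow> r C \<in> ?D \<and> r C \<in> C" by metis
    let ?F = "insert \<one> (r ` (rcosets N))"
    have "finite ?F" using finite_rcosets[OF sN oN] by simp
    moreover have "?F \<subseteq> ?D" using r generate.one by blast
    moreover have "\<exists>f\<in>?F. x \<otimes> inv f \<in> N" if x: "x \<in> carrier G" for x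
    proof -
      let ?f = "r (N #> x)"
      have C: "N #> x \<in> rcosets N" using x by (auto simp: RCOSETS_def)
      then have "?f \<in> N #> x" using r by blast
      then obtain n where n: "n \<in> N" "?f = n \<otimes> x" by (auto simp: r_coset_def)
      have nc: "n \<in> carrier G" using n subgroup.mem_carrier[OF sN] by blast
      have "x \<otimes> inv ?f = inv n" using n(2) nc x by (simp add: inv_mult_group flip: m_assoc)
      then have "x \<otimes> inv ?f \<in> N" using subgroup.m_inv_closed[OF sN n(1)] by simp
      then show ?thesis using C by blast
    qed
    ultimately have "reps N ?F" unfolding reps_def by blast
    then show ?thesis by blast
  qed
  then obtain F where "\<And>N. N \<in> ?N \<Longrightarrow> reps N (F N)" by metis
  then have F: "finite (F N)" "F N \<subseteq> ?D" "\<one> \<in> F N" "\<And>x. x \<in> carrier G \<Longrightarrow> \<exists>f\<in>F N. x \<otimes> inv f \<in> N"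
    if "N \<in> ?N" for N
    using that unfolding reps_def by simp_all
  define R where "R N = {(s, f, f'). s \<in> ?S \<and> f \<in> F N \<and> f' \<in> F N \<and> f \<otimes> s \<otimes> inv f' \<in> N}" for N
  define \<Phi> where "\<Phi> N = (F N, R N, F N \<inter> N)" for N
  have half: "N \<subseteq> N'" if N: "N \<in> ?N" "N' \<in> ?N" and eq: "\<Phi> N = \<Phi> N'" for N N'
  proof -
    have sN: "subgroup N G" "subgroup N' G" "openin T N" "openin T N'" using N by auto
    have eqs: "F N = F N'" "R N = R N'" "F N \<inter> N = F N' \<inter> N'" using eq unfolding \<Phi>_def by auto
    have D: "?D \<inter> N \<subseteq> N'"
    proof (rule generate_Int_subset_if_same_coset_table[OF sN(1,2) S(2)])
      show "F N \<subseteq> carrier G" "\<one> \<in> F N" using F(2,3)[OF N(1)] Dc by auto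
      show "\<exists>f\<in>F N. x \<otimes> inv f \<in> N" if "x \<in> carrier G" for x by (rule F(4)[OF N(1) that])
      show "f \<in> N'" if "f \<in> F N" "f \<in> N" for f using eqs(3) that by blast
      show "f \<otimes> s \<otimes> inv f' \<in> N'"
        if "s \<in> ?S" "f \<in> F N" "f' \<in> F N" "f \<otimes> s \<otimes> inv f' \<in> N" for s f f'
      proof -
        have "(s, f, f') \<in> R N" using that unfolding R_def by blast
        then have "(s, f, f') \<in> R N'" using eqs(2) by simp
        then show ?thesis unfolding R_def by blast
      qed
    qed
    show ?thesis
    proof (rule ccontr)
      assume "\<not> ?thesis"
      then obtain x where x: "x \<in> N" "x \<notin> N'" by blast
      \<comment> \<open>\<open>N'\<close> is closed as well, so a non-empty difference would be open
        and contain a point of \<open>?D\<close>.\<close>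
      have "openin T (N - N')" by (rule openin_diff[OF sN(3) open_subgroup_closed[OF sN(2,4)]])
      then obtain d where "d \<in> ?D" "d \<in> N - N'" using dense_meets_open[OF dense] x by blast
      then show False using D by blast
    qed
  qed
  have "inj_on \<Phi> ?N"
  proof (rule inj_onI)
    fix N N' assume NN: "N \<in> ?N" "N' \<in> ?N" "\<Phi> N = \<Phi> N'"
    show "N = N'"
      by (rule equalityI[OF half[OF NN] half[OF NN(2,1) NN(3)[symmetric]]])
  qed
  moreover have "countable (\<Phi> ` ?N)"
  proof (rule countable_subset)
    let ?fin = "\<lambda>A. {B. finite B \<and> B \<subseteq> A}"
    show "\<Phi> ` ?N \<subseteq> ?fin ?D \<times> ?fin (?S \<times> ?D \<times> ?D) \<times> ?fin ?D"
    proof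
      fix p assume "p \<in> \<Phi> ` ?N"
      then obtain N where N: "N \<in> ?N" "p = \<Phi> N" by blast
      have R: "R N \<subseteq> ?S \<times> F N \<times> F N" unfolding R_def by blast
      moreover have "finite (?S \<times> F N \<times> F N)" using F(1)[OF N(1)] S(1) by simp
      ultimately have "finite (R N)" by (rule finite_subset)
      moreover have "R N \<subseteq> ?S \<times> ?D \<times> ?D" using R F(2)[OF N(1)] by blast
      ultimately show "p \<in> ?fin ?D \<times> ?fin (?S \<times> ?D \<times> ?D) \<times> ?fin ?D"
        using F(1,2)[OF N(1)] unfolding N(2) \<Phi>_def by auto
    qed
    have "countable ?S" using S(1) by (intro countable_finite) simp
    then have "countable (?S \<times> ?D \<times> ?D)" using cD by (intro countable_SIGMA)
    then have "countable (?fin (?S \<times> ?D \<times> ?D))" by (rule countable_Collect_finite_subset)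
    moreover have "countable (?fin ?D)" by (rule countable_Collect_finite_subset[OF cD])
    ultimately show "countable (?fin ?D \<times> ?fin (?S \<times> ?D \<times> ?D) \<times> ?fin ?D)"
      by (intro countable_SIGMA)
  qed
  ultimately show ?thesis using countable_image_inj_on by blast
qed

text \<open>All open normal subgroups are enumerated; they separate each non-trivial element from
  the identity.\<close>

lemma open_normal_sequence:
  assumes "topologically_finitely_generated G T"
  obtains B where "\<And>n::nat. B n \<lhd> G" "\<And>n. openin T (B n)" "(\<Inter>n. B n) = {\<one>}"
proof -
  let ?N = "{N. N \<lhd> G \<and> openin T N}"
  have c: "countable ?N"
    by (rule countable_subset[OF _ countable_open_subgroups[OF assms]]) (use normal_imp_subgroup in blast)
  have "carrier G \<in> ?N" using normal_self openin_topspace[of T] by (simp add: topspace_eq)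
  then have ne: "?N \<noteq> {}" by blast
  have r: "range (from_nat_into ?N) = ?N" by (rule range_from_nat_into[OF ne c])
  define B where "B = from_nat_into ?N"
  have B: "B n \<lhd> G" "openin T (B n)" for n
    using from_nat_into[OF ne, of n] unfolding B_def by auto
  have "(\<Inter>n. B n) = {\<one>}"
  proof (intro equalityI subsetI)
    fix x assume x: "x \<in> (\<Inter>n. B n)"
    show "x \<in> {\<one>}"
    proof (rule ccontr)
      assume "x \<notin> {\<one>}"
      moreover have "x \<in> carrier G" using x open_subset_carrier[OF B(2)[of 0]] by blast
      ultimately obtain N where N: "N \<lhd> G" "openin T N" "x \<notin> N" using open_normal_avoiding[of x] by blast
      then have "N \<in> range B" unfolding B_def r by blast
      then show False using N(3) x by blast
    qed
  next
    fix x assume "x \<in> {\<one>}"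
    then show "x \<in> (\<Inter>n. B n)" using subgroup.one_closed[OF normal_imp_subgroup[OF B(1)]] by blast
  qed
  with B show ?thesis by (rule that)
qed

end

section \<open>The two implications\<close>

context profinite_group
begin

section \<open>From the hereditary property to the sequence\<close>

lemma hereditarily_JNNFD:
  assumes "hereditarily_JNNF c G T" "subgroup U G" "openin T U"
  shows "JNNF c (G\<lparr>carrier := U\<rparr>) (subtopology T U)"
  using assms unfolding hereditarily_JNNF_def open_subgroup_def by blast

lemma hereditarily_JNNF_imp_JNNF:
  assumes "hereditarily_JNNF c G T"
  shows "JNNF c G T"
proof -
  have "openin T (carrier G)" using openin_topspace[of T] by (simp add: topspace_eq)
  then have "JNNF c (G\<lparr>carrier := carrier G\<rparr>) (subtopology T (carrier G))"
    by (rule hereditarily_JNNFD[OF assms subgroup_self])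
  then show ?thesis using subtopology_topspace[of T] by (simp add: topspace_eq)
qed

text \<open>An abelian normal \<open>A\<close> of \<open>M\<close> meets an open normal subgroup of
  \<open>G\<close> inside \<open>M\<close> in an abelian subgroup normalized by it, which is
  trivial. So \<open>A\<close> is finite, and \<open>fin\<close> excludes this unless
  \<open>A\<close> is trivial.\<close>

lemma fitting_free_open_subgroup:
  assumes ff: "fitting_free G T" and M: "subgroup M G" "openin T M"
    and fin: "\<And>F. F \<lhd> G\<lparr>carrier := M\<rparr> \<Longrightarrow> finite F \<Longrightarrow> F = {\<one>}"
  shows "fitting_free (G\<lparr>carrier := M\<rparr>) (subtopology T M)"
  unfolding fitting_free_def
proof (intro allI impI, elim conjE)
  fix A assume A: "A \<lhd> G\<lparr>carrier := M\<rparr>" and comm: "comm_group (G\<lparr>carrier := M, carrier := A\<rparr>)"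
  interpret A: comm_group "G\<lparr>carrier := A\<rparr>" using comm by simp
  have AM: "A \<subseteq> M" using subgroup.subset[OF normal_imp_subgroup[OF A]] by simp
  have sA: "subgroup A G" and conj: "\<And>m a. m \<in> M \<Longrightarrow> a \<in> A \<Longrightarrow> m \<otimes> a \<otimes> inv m \<in> A"
    using A unfolding normal_restrict_iff[OF M(1) AM] by blast+
  obtain N where N: "N \<lhd> G" "openin T N" "N \<subseteq> M"
    using open_normal_in_nbhd[OF M(2) subgroup.one_closed[OF M(1)]] .
  have sN: "subgroup N G" using N(1) by (rule normal_imp_subgroup)
  have "A \<inter> N = {\<one>}"
  proof (rule fitting_free_abelian_normal_in_open[OF ff N(1,2)])
    show "subgroup (A \<inter> N) G" by (rule subgroups_Inter_pair[OF sA sN])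
    show "m \<otimes> a \<otimes> inv m \<in> A \<inter> N" if "m \<in> N" "a \<in> A \<inter> N" for m a
      using that conj N(3) normal_conj[OF N(1)] subgroup.mem_carrier[OF sN] by blast
    show "x \<otimes> y = y \<otimes> x" if "x \<in> A \<inter> N" "y \<in> A \<inter> N" for x y
      using A.m_comm[of x y] that by simp
  qed blast
  then have "finite A" by (intro finite_if_meets_open_trivially[OF sA sN N(2)]) blast
  then show "A = {\<one>\<^bsub>G\<lparr>carrier := M\<rparr>\<^esub>}" using fin[OF A] by simp
qed

text \<open>Each relevant \<open>L\<close> gives a subgroup \<open>L <#> K\<close> above
  \<open>K\<close> in which the series term of \<open>L\<close> is normal. Only finitely many
  subgroups lie above \<open>K\<close>, so the bounds obtained inside each can be
  intersected.\<close>

lemma JNNF_step: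
  assumes h: "hereditarily_JNNF c G T" and ff: "fitting_free G T" and K: "K \<lhd> G" "openin T K"
  shows "\<exists>U. U \<lhd> G \<and> openin T U \<and>
    (\<forall>L. open_subgroup G T L \<and> K \<subseteq> normalizer G L \<longrightarrow>
      lower_central G T (c + 1) L \<subseteq> K \<or> lower_central G T (c + 1) U \<subseteq> lower_central G T (c + 1) L)"
proof -
  let ?g = "lower_central G T (c + 1)" and ?S = "{M. subgroup M G \<and> K \<subseteq> M}"
  have sK: "subgroup K G" using K(1) by (rule normal_imp_subgroup)
  \<comment> \<open>Inside \<open>M\<close> the bound comes as a subgroup normal in \<open>M\<close>
    only; being an open neighbourhood of the identity is kept, and a normal subgroup of
    \<open>G\<close> is found inside the finite intersection.\<close>
  define good where "good M U \<longleftrightarrow> openin T U \<and> \<one> \<in> U \<and>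
      (\<forall>R. R \<lhd> G\<lparr>carrier := M\<rparr> \<and> closedin T R \<and> \<not> R \<subseteq> K \<longrightarrow> ?g U \<subseteq> R)" for M U
  have "\<exists>U. good M U" if "M \<in> ?S" for M
  proof -
    have M: "subgroup M G" "K \<subseteq> M" using that by auto
    have oM: "openin T M" by (rule openin_subgroup_mono[OF M(1) sK K(2) M(2)])
    have cM: "closedin T M" by (rule open_subgroup_closed[OF M(1) oM])
    interpret M: profinite_group "G\<lparr>carrier := M\<rparr>" "subtopology T M"
      by (rule profinite_closed_subgroup[OF M(1) cM])
    have J: "JNNF c (G\<lparr>carrier := M\<rparr>) (subtopology T M)" by (rule hereditarily_JNNFD[OF h M(1) oM])
    have "fitting_free (G\<lparr>carrier := M\<rparr>) (subtopology T M)"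
      using M.JNNF_no_finite_normal[OF J] by (intro fitting_free_open_subgroup[OF ff M(1) oM]) simp
    moreover have "subgroup K (G\<lparr>carrier := M\<rparr>)" by (rule subgroup_incl[OF sK M(1,2)])
    moreover have "openin (subtopology T M) K" using openin_open_subtopology[OF oM] K(2) M(2) by simp
    ultimately obtain U where U: "U \<lhd> G\<lparr>carrier := M\<rparr>" "openin (subtopology T M) U"
      and R: "\<And>R. R \<lhd> G\<lparr>carrier := M\<rparr> \<Longrightarrow> closedin (subtopology T M) R \<Longrightarrow> \<not> R \<subseteq> K \<Longrightarrow>
        lower_central (G\<lparr>carrier := M\<rparr>) (subtopology T M) (c + 1) U \<subseteq> R"
      using M.JNNF_uniform[OF J] by metis
    have oU: "openin T U" "U \<subseteq> M" using U(2) openin_open_subtopology[OF oM] by auto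
    have "\<one> \<in> U" using subgroup.one_closed[OF normal_imp_subgroup[OF U(1)]] by simp
    moreover have "?g U \<subseteq> R" if R': "R \<lhd> G\<lparr>carrier := M\<rparr>" "closedin T R" "\<not> R \<subseteq> K" for R
    proof -
      have "R \<subseteq> M" using subgroup.subset[OF normal_imp_subgroup[OF R'(1)]] by simp
      then have "closedin (subtopology T M) R" using closedin_closed_subtopology[OF cM] R'(2) by simp
      from R[OF R'(1) this R'(3)] show ?thesis
        using lower_central_restrict[OF M(1) cM oU(2), of "c + 1"] by simp
    qed
    ultimately have "good M U" using oU(1) unfolding good_def by blast
    then show ?thesis by blast
  qed
  then obtain u where "\<And>M. M \<in> ?S \<Longrightarrow> good M (u M)" by metis
  then have u: "openin T (u M)" "\<one> \<in> u M"
      "\<And>R. R \<lhd> G\<lparr>carrier := M\<rparr> \<Longrightarrow> closedin T R \<Longrightarrow> \<not> R \<subseteq> K \<Longrightarrow> ?g (u M) \<subseteq> R"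
    if "M \<in> ?S" for M
    using that unfolding good_def by simp_all
  have fin: "finite ?S" by (rule finite_subgroups_above[OF sK K(2)])
  let ?U = "\<Inter>(insert K (u ` ?S))"
  have oU: "openin T W" if "W \<in> insert K (u ` ?S)" for W using that u(1) K(2) by blast
  have "openin T ?U" by (rule openin_Inter) (use fin oU in auto)
  moreover have "\<one> \<in> ?U" using u(2) subgroup.one_closed[OF sK] by blast
  ultimately obtain N where N: "N \<lhd> G" "openin T N" "N \<subseteq> ?U" using open_normal_in_nbhd by blast
  have "?g N \<subseteq> ?g L" if L: "open_subgroup G T L" "K \<subseteq> normalizer G L" "\<not> ?g L \<subseteq> K" for L
  proof -
    have sL: "subgroup L G" "openin T L" using L(1) unfolding open_subgroup_def by auto
    have cL: "closedin T L" by (rule open_subgroup_closed[OF sL])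
    have Lc: "L \<subseteq> carrier G" by (rule subgroup.subset[OF sL(1)])
    have conj: "k \<otimes> x \<otimes> inv k \<in> L" if "k \<in> K" "x \<in> L" for k x
      using normalizer_conj[OF Lc _ that(2)] L(2) that(1) by blast
    let ?M = "L <#> K"
    have sM: "subgroup ?M G" by (rule subgroup_set_mult[OF sL(1) sK conj])
    have KM: "K \<subseteq> ?M" by (rule subset_set_mult_right[OF sL(1) subgroup.subset[OF sK]])
    have LM: "L \<subseteq> ?M" by (rule subset_set_mult_left[OF sK Lc])
    have gLM: "?g L \<subseteq> ?M" using lower_central_subset[OF sL(1) cL] LM by blast
    \<comment> \<open>Elements of both factors of \<open>?M\<close> normalize \<open>L\<close>,
      hence also the terms of its series.\<close>
    have "?g L \<lhd> G\<lparr>carrier := ?M\<rparr>"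
      unfolding normal_restrict_iff[OF sM gLM]
    proof (intro conjI ballI)
      show "subgroup (?g L) G" by (rule lower_central_subgroup[OF sL(1) cL])
      fix m x assume m: "m \<in> ?M" and x: "x \<in> ?g L"
      obtain l k where lk: "l \<in> L" "k \<in> K" "m = l \<otimes> k" using m unfolding in_set_mult_iff by blast
      have c: "l \<in> carrier G" "k \<in> carrier G"
        using lk subgroup.mem_carrier[OF sL(1)] subgroup.mem_carrier[OF sK] by auto
      show "m \<otimes> x \<otimes> inv m \<in> ?g L"
      proof (rule lower_central_conj[OF sL(1) cL _ _ x])
        show "m \<in> carrier G" using lk(3) c by simp
        fix y assume y: "y \<in> L"
        have yc: "y \<in> carrier G" using y Lc by blast
        have "m \<otimes> y \<otimes> inv m = l \<otimes> (k \<otimes> y \<otimes> inv k) \<otimes> inv l"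
          using lk(3) c yc by (simp add: m_assoc inv_mult_group)
        then show "m \<otimes> y \<otimes> inv m \<in> L"
          using subgroup.m_closed[OF sL(1) subgroup.m_closed[OF sL(1) lk(1) conj[OF lk(2) y]]
              subgroup.m_inv_closed[OF sL(1) lk(1)]] by simp
      qed
    qed
    moreover have "closedin T (?g L)" by (rule lower_central_closedin[OF sL(1) cL])
    moreover have MS: "?M \<in> ?S" using sM KM by blast
    ultimately have "?g (u ?M) \<subseteq> ?g L" using u(3)[OF MS] L(3) by blast
    moreover have "N \<subseteq> u ?M" using N(3) MS by blast
    ultimately show ?thesis using lower_central_mono[of N "u ?M" "c + 1"] by blast
  qed
  then show ?thesis using N(1,2) by blast
qed

text \<open>Dependent choice along the one-step lemma, with \<open>B n\<close> used at step
  \<open>n\<close> to force trivial intersection.\<close>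

lemma hereditarily_JNNF_imp_sequence:
  assumes h: "hereditarily_JNNF c G T" and ff: "fitting_free G T"
    and fg: "topologically_finitely_generated G T"
  shows "\<exists>H :: nat \<Rightarrow> 'a set. (\<forall>n. H n \<lhd> G \<and> openin T (H n)) \<and> (\<forall>n. H (Suc n) \<subset> H n) \<and>
       (\<Inter>n. H n) = {\<one>} \<and>
       (\<forall>n\<ge>1. \<forall>L. open_subgroup G T L \<and> H (n - 1) \<subseteq> normalizer G L \<longrightarrow>
          lower_central G T (c + 1) L \<subseteq> H (n - 1) \<or>
          lower_central G T (c + 1) (H n) \<subseteq> lower_central G T (c + 1) L)"
proof -
  obtain B where B: "\<And>n::nat. B n \<lhd> G" "\<And>n. openin T (B n)" "(\<Inter>n. B n) = {\<one>}"
    using open_normal_sequence[OF fg] by blast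
  have J: "JNNF c G T" by (rule hereditarily_JNNF_imp_JNNF[OF h])
  define P where "P K \<longleftrightarrow> K \<lhd> G \<and> openin T K" for K
  define Q where "Q n K K' \<longleftrightarrow> K' \<subset> K \<and> K' \<subseteq> B n \<and>
      (\<forall>L. open_subgroup G T L \<and> K \<subseteq> normalizer G L \<longrightarrow>
        lower_central G T (c + 1) L \<subseteq> K \<or> lower_central G T (c + 1) K' \<subseteq> lower_central G T (c + 1) L)"
    for n K K'
  have "\<exists>H. \<forall>n. P (H n) \<and> Q n (H n) (H (Suc n))"
  proof (rule dependent_nat_choice)
    show "\<exists>K. P K"
      unfolding P_def using normal_self openin_topspace[of T] topspace_eq by metis
    fix K n assume "P K"
    then have K: "K \<lhd> G" "openin T K" unfolding P_def by auto
    have sK: "subgroup K G" using K(1) by (rule normal_imp_subgroup)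
    \<comment> \<open>A trivial open subgroup would make \<open>G\<close> virtually nilpotent; so
      \<open>K\<close> has an element \<open>x\<close> that the next subgroup can omit.\<close>
    have "K \<noteq> {\<one>}"
    proof
      assume "K = {\<one>}"
      then have "lower_central G T (c + 1) K = {\<one>}"
        using lower_central_subset[OF sK normal_open_closed[OF K]]
          one_in_lower_central[OF sK normal_open_closed[OF K]] by blast
      then show False using J sK K(2) unfolding JNNF_iff open_subgroup_def by blast
    qed
    then obtain x where x: "x \<in> K" "x \<noteq> \<one>" using subgroup.one_closed[OF sK] by blast
    obtain V where V: "V \<lhd> G" "openin T V" "x \<notin> V"
      using open_normal_avoiding[OF subgroup.mem_carrier[OF sK x(1)] x(2)] .
    obtain U where U: "U \<lhd> G" "openin T U" "\<And>L. open_subgroup G T L \<Longrightarrow> K \<subseteq> normalizer G L \<Longrightarrow>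
        lower_central G T (c + 1) L \<subseteq> K \<or> lower_central G T (c + 1) U \<subseteq> lower_central G T (c + 1) L"
      using JNNF_step[OF h ff K] by blast
    \<comment> \<open>\<open>B n\<close> controls the intersection of the sequence, \<open>U\<close>
      gives the dichotomy and \<open>V\<close> omits \<open>x\<close>, which makes the descent
      strict.\<close>
    let ?K = "(K \<inter> B n) \<inter> (U \<inter> V)"
    have "P ?K" unfolding P_def
      by (intro conjI normal_subgroup_intersect openin_Int K B V U)
    moreover have "lower_central G T (c + 1) ?K \<subseteq> lower_central G T (c + 1) U"
      by (rule lower_central_mono) blast
    then have "Q n K ?K" unfolding Q_def using x(1) V(3) U(3) by blast
    ultimately show "\<exists>K'. P K' \<and> Q n K K'" by blast
  qed
  then obtain H where H: "\<And>n. P (H n)" "\<And>n. Q n (H n) (H (Suc n))" by blast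
  have "(\<Inter>n. H n) = {\<one>}"
  proof
    have "H (Suc n) \<subseteq> B n" for n using H(2)[of n] unfolding Q_def by blast
    then have "(\<Inter>n. H n) \<subseteq> (\<Inter>n. B n)" by blast
    then show "(\<Inter>n. H n) \<subseteq> {\<one>}" using B(3) by simp
    have "\<one> \<in> H n" for n
      using H(1)[of n] subgroup.one_closed[OF normal_imp_subgroup[of "H n" G]] unfolding P_def by blast
    then show "{\<one>} \<subseteq> (\<Inter>n. H n)" by blast
  qed
  moreover have "lower_central G T (c + 1) L \<subseteq> H (n - 1) \<or>
      lower_central G T (c + 1) (H n) \<subseteq> lower_central G T (c + 1) L"
    if "n \<ge> 1" "open_subgroup G T L" "H (n - 1) \<subseteq> normalizer G L" for n L
  proof -
    have "Q (n - 1) (H (n - 1)) (H n)" using H(2)[of "n - 1"] that(1) by simp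
    then show ?thesis unfolding Q_def using that(2,3) by blast
  qed
  moreover have "H n \<lhd> G \<and> openin T (H n)" "H (Suc n) \<subset> H n" for n
    using H(1)[of n] H(2)[of n] unfolding P_def Q_def by blast+
  ultimately show ?thesis by (intro exI[of _ H]) blast
qed

section \<open>From the sequence to the hereditary property\<close>

lemma sequence_imp_hereditarily_JNNF:
  assumes ff: "fitting_free G T"
    and H: "\<And>n. H n \<lhd> G" "\<And>n. openin T (H n)" and strict: "\<And>n::nat. H (Suc n) \<subset> H n"
    and int: "(\<Inter>n. H n) = {\<one>}"
    and dich: "\<And>n L. n \<ge> 1 \<Longrightarrow> open_subgroup G T L \<Longrightarrow> H (n - 1) \<subseteq> normalizer G L \<Longrightarrow>
          lower_central G T (c + 1) L \<subseteq> H (n - 1) \<or>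
          lower_central G T (c + 1) (H n) \<subseteq> lower_central G T (c + 1) L"
  shows "hereditarily_JNNF c G T"
proof -
  let ?g = "lower_central G T (c + 1)"
  have sH: "subgroup (H n) G" for n using H(1) by (rule normal_imp_subgroup)
  have cH: "closedin T (H n)" for n by (rule normal_open_closed[OF H])
  have anti: "H n \<subseteq> H m" if "m \<le> n" for m n
    by (rule lift_Suc_antimono_le[of H, OF _ that]) (use strict in blast)
  \<comment> \<open>By compactness a descending sequence of closed sets with trivial intersection is
    eventually inside every neighbourhood of the identity.\<close>
  have small: "\<exists>m. H m \<subseteq> U" if U: "openin T U" "\<one> \<in> U" for U
  proof -
    have "\<exists>C\<in>range H. C \<subseteq> U"
    proof (rule directed_Inter_subset_open[OF _ _ _ U(1)])
      fix C D assume "C \<in> range H" "D \<in> range H"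
      then obtain m n where "C = H m" "D = H n" by blast
      then have "H (max m n) \<subseteq> C \<inter> D" using anti[of m "max m n"] anti[of n "max m n"] by simp
      then show "\<exists>E\<in>range H. E \<subseteq> C \<inter> D" by blast
    qed (use cH int U(2) in auto)
    then show ?thesis by blast
  qed
  have gH: "?g (H n) \<noteq> {\<one>}" for n
  proof -
    have "H n \<noteq> {\<one>}" using strict[of n] subgroup.one_closed[OF sH[of "Suc n"]] by auto
    then show ?thesis using lower_central_nontrivial[OF ff H(1) cH, of n c] by simp
  qed
  have main: "\<exists>n\<ge>k. ?g (H n) \<subseteq> N"
    if N: "subgroup N G" "closedin T N" and conj: "\<And>h x. h \<in> H k \<Longrightarrow> x \<in> N \<Longrightarrow> h \<otimes> x \<otimes> inv h \<in> N"
      and nt: "?g N \<noteq> {\<one>}" for N k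
  proof -
    have "\<one> \<in> ?g N" by (rule one_in_lower_central[OF N])
    then obtain x where x: "x \<in> ?g N" "x \<noteq> \<one>" using nt by blast
    then obtain n0 where n0: "x \<notin> H n0" using int by blast
    \<comment> \<open>\<open>H p\<close> lies in \<open>H k\<close>, hence normalizes
      \<open>N\<close>, and it omits \<open>x\<close>. Since \<open>x\<close> is in the series term
      of every \<open>N <#> H m\<close>, the first alternative of the dichotomy fails for all
      \<open>m\<close> at the same index \<open>p\<close>.\<close>
    define p where "p = max k n0"
    have p: "H p \<subseteq> H k" "x \<notin> H p" using anti[of k p] anti[of n0 p] n0 unfolding p_def by auto
    have step: "?g (H (Suc p)) \<subseteq> N <#> H m" if m: "m \<ge> k" for m
    proof -
      have mk: "H m \<subseteq> H k" by (rule anti[OF m])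
      let ?L = "N <#> H m"
      have Nc: "N \<subseteq> carrier G" by (rule subgroup.subset[OF N(1)])
      have cm: "h \<otimes> y \<otimes> inv h \<in> N" if "h \<in> H m" "y \<in> N" for h y using conj that mk by blast
      have sL: "subgroup ?L G" by (rule subgroup_set_mult[OF N(1) sH cm])
      have L: "open_subgroup G T ?L"
        unfolding open_subgroup_def using sL openin_set_mult[OF H(2) Nc] by blast
      have "H p \<subseteq> normalizer G ?L"
      proof (rule subset_normalizerI[OF subgroup.subset[OF sL] sH])
        fix h y assume h: "h \<in> H p" and y: "y \<in> ?L"
        have hc: "h \<in> carrier G" using h subgroup.mem_carrier[OF sH] by blast
        obtain a b where ab: "a \<in> N" "b \<in> H m" "y = a \<otimes> b" using y unfolding in_set_mult_iff by blast
        have c: "a \<in> carrier G" "b \<in> carrier G" using ab Nc subgroup.mem_carrier[OF sH] by auto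
        have "h \<otimes> y \<otimes> inv h = (h \<otimes> a \<otimes> inv h) \<otimes> (h \<otimes> b \<otimes> inv h)"
          unfolding ab(3) by (rule conj_mult[OF hc c])
        moreover have "h \<otimes> a \<otimes> inv h \<in> N" using conj h p(1) ab(1) by blast
        moreover have "h \<otimes> b \<otimes> inv h \<in> H m" by (rule normal_conj[OF H(1) hc ab(2)])
        ultimately show "h \<otimes> y \<otimes> inv h \<in> ?L" unfolding in_set_mult_iff by blast
      qed
      moreover have "x \<in> ?g ?L"
        using x(1) lower_central_mono[OF subset_set_mult_left[OF sH Nc], of "c + 1" m] by blast
      ultimately have "?g (H (Suc p)) \<subseteq> ?g ?L" using dich[of "Suc p", OF _ L] p(2) by auto
      also have "\<dots> \<subseteq> N <#> lower_central G T (Suc c) (H m)"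
        using lower_central_set_mult_subset[OF N(1) sH cH cm, of m c]
          closedin_set_mult[OF N(2) lower_central_closedin[OF sH cH]] by simp
      also have "\<dots> \<subseteq> N <#> H m"
        by (rule mono_set_mult[OF order_refl lower_central_subset[OF sH cH]])
      finally show ?thesis .
    qed
    have "?g (H (Suc p)) \<subseteq> N"
    proof
      fix y assume y: "y \<in> ?g (H (Suc p))"
      show "y \<in> N"
      proof (rule ccontr)
        assume yN: "y \<notin> N"
        have yc: "y \<in> carrier G"
          using y lower_central_subset[OF sH cH] subgroup.mem_carrier[OF sH] by blast
        obtain W where W: "W \<lhd> G" "openin T W" "y \<notin> N <#> W"
          using open_normal_separating[OF N(2) yc yN] .
        obtain m where m: "H m \<subseteq> W"
          using small[OF W(2) subgroup.one_closed[OF normal_imp_subgroup[OF W(1)]]] by blast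
        \<comment> \<open>The maximum is taken because \<open>step\<close> is available only from
          \<open>k\<close> onwards.\<close>
        have "y \<in> N <#> H (max k m)" using step[of "max k m"] y by auto
        also have "\<dots> \<subseteq> N <#> W" using anti[of m "max k m"] m by (intro mono_set_mult) auto
        finally show False using W(3) by blast
      qed
    qed
    moreover have "Suc p \<ge> k" unfolding p_def by simp
    ultimately show ?thesis by blast
  qed
  have cent: "centralizer G (H k) = {\<one>}" for k
  proof (rule ccontr)
    let ?C = "centralizer G (H k)"
    assume nt: "?C \<noteq> {\<one>}"
    have Hc: "H k \<subseteq> carrier G" by (rule subgroup.subset[OF sH])
    have C: "?C \<lhd> G" by (rule normal_centralizer[OF Hc normal_conj[OF H(1)]])
    have cC: "closedin T ?C" by (rule closedin_centralizer[OF Hc])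
    \<comment> \<open>This intersection is the centre of \<open>H k\<close>, abelian and normal in
      \<open>G\<close>. If \<open>?C\<close> were non-trivial, \<open>main\<close> would put some
      non-trivial \<open>?g (H n)\<close> into it; \<open>n \<ge> k\<close> ensures that this term
      lies in \<open>H k\<close>.\<close>
    have CH: "?C \<inter> H k = {\<one>}"
    proof (rule fitting_freeD[OF ff normal_subgroup_intersect[OF C H(1)] closedin_Int[OF cC cH]])
      show "x \<otimes> y = y \<otimes> x" if "x \<in> ?C \<inter> H k" "y \<in> ?C \<inter> H k" for x y
        using that unfolding centralizer_def by blast
    qed
    have "?g ?C \<noteq> {\<one>}" using lower_central_nontrivial[OF ff C cC nt, of c] by simp
    moreover have "h \<otimes> x \<otimes> inv h \<in> ?C" if "h \<in> H k" "x \<in> ?C" for h x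
      using normal_conj[OF C] that Hc by blast
    ultimately obtain n where n: "n \<ge> k" "?g (H n) \<subseteq> ?C"
      using main[OF normal_imp_subgroup[OF C] cC] by blast
    have "?g (H n) \<subseteq> H k" using lower_central_subset[OF sH cH] anti[OF n(1)] by blast
    then have "?g (H n) = {\<one>}" using n(2) CH one_in_lower_central[OF sH cH] by blast
    then show False using gH by blast
  qed
  show ?thesis
    unfolding hereditarily_JNNF_def
  proof (intro allI impI)
    fix U assume "open_subgroup G T U"
    then have U: "subgroup U G" "openin T U" unfolding open_subgroup_def by auto
    have cU: "closedin T U" by (rule open_subgroup_closed[OF U])
    obtain k where k: "H k \<subseteq> U" using small[OF U(2) subgroup.one_closed[OF U(1)]] by blast
    interpret U: profinite_group "G\<lparr>carrier := U\<rparr>" "subtopology T U"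
      by (rule profinite_closed_subgroup[OF U(1) cU])
    note lcU = lower_central_restrict[OF U(1) cU]
    have ffU: "fitting_free (G\<lparr>carrier := U\<rparr>) (subtopology T U)"
    proof (rule fitting_free_open_subgroup[OF ff U])
      fix F assume F: "F \<lhd> G\<lparr>carrier := U\<rparr>" "finite F"
      have FU: "F \<subseteq> U" using subgroup.subset[OF normal_imp_subgroup[OF F(1)]] by simp
      have sF: "subgroup F G" and conj: "\<And>u f. u \<in> U \<Longrightarrow> f \<in> F \<Longrightarrow> u \<otimes> f \<otimes> inv u \<in> F"
        using F(1) unfolding normal_restrict_iff[OF U(1) FU] by blast+
      have Fc: "F \<subseteq> carrier G" by (rule subgroup.subset[OF sF])
      obtain W where W: "W \<lhd> G" "openin T W" "W \<inter> F \<subseteq> {\<one>}"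
        using finite_meets_open_trivially[OF F(2) Fc] .
      obtain m where m: "H m \<subseteq> W \<inter> U"
        using small[OF openin_Int[OF W(2) U(2)]] subgroup.one_closed[OF normal_imp_subgroup[OF W(1)]]
          subgroup.one_closed[OF U(1)] by blast
      \<comment> \<open>\<open>F\<close> and \<open>H m\<close> normalize each other and meet
        trivially, so they commute; by \<open>cent\<close> this makes \<open>F\<close>
        trivial.\<close>
      have "F \<subseteq> centralizer G (H m)"
      proof
        fix f assume f: "f \<in> F"
        have fc: "f \<in> carrier G" using f Fc by blast
        have "f \<otimes> h = h \<otimes> f" if h: "h \<in> H m" for h
        proof -
          have hc: "h \<in> carrier G" using h subgroup.mem_carrier[OF sH] by blast
          have hU: "h \<in> U" using h m by blast
          have "f \<otimes> h \<otimes> inv f \<otimes> inv h \<in> H m"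
            by (rule subgroup.m_closed[OF sH normal_conj[OF H(1) fc h] subgroup.m_inv_closed[OF sH h]])
          moreover have "f \<otimes> (h \<otimes> inv f \<otimes> inv h) \<in> F"
            by (rule subgroup.m_closed[OF sF f conj[OF hU subgroup.m_inv_closed[OF sF f]]])
          ultimately have "f \<otimes> h \<otimes> inv f \<otimes> inv h = \<one>" using m W(3) fc hc by (auto simp: m_assoc)
          then show ?thesis using commutator_eq_one_iff[OF fc hc] by simp
        qed
        then show "f \<in> centralizer G (H m)" using fc unfolding centralizer_def by blast
      qed
      then show "F = {\<one>}" using cent[of m] subgroup.one_closed[OF sF] by blast
    qed
    show "JNNF c (G\<lparr>carrier := U\<rparr>) (subtopology T U)"
      unfolding U.JNNF_iff
    proof (intro conjI notI allI impI)
      assume "\<exists>V. open_subgroup (G\<lparr>carrier := U\<rparr>) (subtopology T U) V \<and>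
        lower_central (G\<lparr>carrier := U\<rparr>) (subtopology T U) (c + 1) V = {\<one>\<^bsub>G\<lparr>carrier := U\<rparr>\<^esub>}"
      then obtain V where V: "subgroup V (G\<lparr>carrier := U\<rparr>)" "openin (subtopology T U) V"
        "lower_central (G\<lparr>carrier := U\<rparr>) (subtopology T U) (c + 1) V = {\<one>}"
        unfolding open_subgroup_def by auto
      have oV: "openin T V" "V \<subseteq> U" using V(2) openin_open_subtopology[OF U(2)] by auto
      obtain m where m: "H m \<subseteq> V" using small[OF oV(1)] subgroup.one_closed[OF V(1)] by auto
      have "?g V = {\<one>}" using V(3) lcU[OF oV(2), of "c + 1"] by simp
      then have "?g (H m) = {\<one>}"
        using lower_central_mono[OF m, of "c + 1"] one_in_lower_central[OF sH[of m] cH[of m], of "c + 1"] by blast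
      then show False using gH by blast
    next
      fix N assume "N \<lhd> G\<lparr>carrier := U\<rparr> \<and> closedin (subtopology T U) N \<and> N \<noteq> {\<one>\<^bsub>G\<lparr>carrier := U\<rparr>\<^esub>}"
      then have N: "N \<lhd> G\<lparr>carrier := U\<rparr>" "closedin (subtopology T U) N" "N \<noteq> {\<one>\<^bsub>G\<lparr>carrier := U\<rparr>\<^esub>}" by auto
      have cN: "closedin T N" "N \<subseteq> U" using N(2) closedin_closed_subtopology[OF cU] by auto
      have sN: "subgroup N G" and conj: "\<And>u f. u \<in> U \<Longrightarrow> f \<in> N \<Longrightarrow> u \<otimes> f \<otimes> inv u \<in> N"
        using N(1) unfolding normal_restrict_iff[OF U(1) cN(2)] by blast+
      \<comment> \<open>\<open>U\<close> has inherited being Fitting-free, so \<open>main\<close>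
        applies to \<open>N\<close> and yields an \<open>H n\<close> inside \<open>U\<close> with
        series term inside \<open>N\<close>.\<close>
      have "?g N \<noteq> {\<one>}"
        using U.lower_central_nontrivial[OF ffU N, of c] lcU[OF cN(2), of "Suc c"] by simp
      then obtain n where n: "n \<ge> k" "?g (H n) \<subseteq> N"
        using main[OF sN cN(1), of k] conj k by blast
      have HU: "H n \<subseteq> U" using anti[OF n(1)] k by blast
      have "open_subgroup (G\<lparr>carrier := U\<rparr>) (subtopology T U) (H n)"
        unfolding open_subgroup_def
        using subgroup_incl[OF sH U(1) HU] openin_open_subtopology[OF U(2)] H(2) HU by blast
      then show "\<exists>V. open_subgroup (G\<lparr>carrier := U\<rparr>) (subtopology T U) V \<and>
        lower_central (G\<lparr>carrier := U\<rparr>) (subtopology T U) (c + 1) V \<subseteq> N"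
        using n(2) lcU[OF HU, of "c + 1"] by auto
    qed
  qed
qed

end

theorem theorem4p6:
  fixes G :: "('a, 'b) monoid_scheme" and T :: "'a topology" and c :: nat
  assumes "profinite_group G T"
    and "topologically_finitely_generated G T"
    and "fitting_free G T"
  shows "hereditarily_JNNF c G T \<longleftrightarrow>
    (\<exists>H :: nat \<Rightarrow> 'a set.
       (\<forall>n. H n \<lhd> G \<and> openin T (H n)) \<and>
       (\<forall>n. H (Suc n) \<subset> H n) \<and>
       (\<Inter>n. H n) = {\<one>\<^bsub>G\<^esub>} \<and>
       (\<forall>n\<ge>1. \<forall>L. open_subgroup G T L \<and> H (n - 1) \<subseteq> normalizer G L \<longrightarrow>
          lower_central G T (c + 1) L \<subseteq> H (n - 1) \<or>
          lower_central G T (c + 1) (H n) \<subseteq> lower_central G T (c + 1) L))"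
  using profinite_group.hereditarily_JNNF_imp_sequence[OF assms(1) _ assms(3,2)]
    profinite_group.sequence_imp_hereditarily_JNNF[OF assms(1,3)] by (intro iffI) (blast, metis)

end
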